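(* Let $G$ be the simply connected Lie group whose Lie algebra $\mathfrak{g}$ is the split real form of type $G_2$, $L\subset G$ the connected Lie subgroup with Lie algebra $\mathfrak{l}$ (the standard Iwasawa subgroup), and $S=G/G_{ev}$ with base point $o=eG_{ev}$. Let $a'=\exp(e^1+e_3^1)$, $a''=\exp(e_3^2+e^1)$, $L'=a'L(a')^{-1}$, $L''=a''L(a'')^{-1}$, and let $M'=L'\cdot o$, $M''=L''\cdot o\subset S$ be the corresponding open orbits. Then the corresponding open $L$-orbits $L\cdot o'$ and $L\cdot o''$, where $o'=(a')^{-1}\cdot o$ and $o''=(a'')^{-1}\cdot o$, are disjoint.
   Context: Lie algebra $\mathfrak{g}$: $V=\mathbb{R}^3$ with standard basis $(e_1,e_2,e_3)$, dual basis $(e^1,e^2,e^3)$ of $V^*$, and $e_i^j=e_i\otimes e^j\in\mathfrak{gl}(V)$. As a vector space $\mathfrak{g}=V\oplus\mathfrak{sl}(V)\oplus V^*$; $\mathfrak{sl}(V)$ is a subalgebra acting on $V$ and $V^*$ by the standard and the dual representation, and the remaining brackets are, for $x,y\in V$, $\xi,\eta\in V^*$, $[x,y]=-2\,x\times y$, $[\xi,\eta]=2\,\xi\times\eta$, $[x,\xi]=3x\otimes\xi-\xi(x)\mathrm{Id}\in\mathfrak{sl}(V)$, where $x\times y=\det(x,y,\cdot)\in V^*$ and $\xi\times\eta=\det^{-1}(\xi,\eta,\cdot)\in V^{**}=V$ (so $e_1\times e_2=e^3$, $e^1\times e^2=e_3$, and cyclically). $\mathfrak{a}=\{\sum_i\lambda_ie_i^i\mid\sum_i\lambda_i=0\}$.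 $\mathfrak{g}_{ev}=\mathfrak{a}+\mathrm{span}\{e_3,e^3,e_1^2,e_2^1\}\cong\mathfrak{sl}_2\oplus\mathfrak{sl}_2$, $\mathfrak{l}=\mathfrak{a}+\mathrm{span}\{e_1,e^2,e^3,e_1^2,e_1^3,e_2^3\}$. $G_{ev}\subset G$ is the connected Lie subgroup with Lie algebra $\mathfrak{g}_{ev}$. One has $M'=a'\cdot(L\cdot o')$ and $M''=a''\cdot(L\cdot o'')$. *)

theory Defs
  imports
    "HOL-Analysis.Analysis"
    "HOL-Algebra.Group_Action"
    "HOL-Algebra.Left_Coset"
begin

section \<open>Smooth maps between open subsets of Euclidean spaces\<close>

text \<open>Both notions are only meaningful for open \<open>S\<close>.\<close>

primrec Ck_on :: "nat \<Rightarrow> 'a set \<Rightarrow> ('a::euclidean_space \<Rightarrow> 'b::euclidean_space) \<Rightarrow> bool" where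
  "Ck_on 0 S f \<longleftrightarrow> continuous_on S f"
| "Ck_on (Suc k) S f \<longleftrightarrow>
     (\<forall>x\<in>S. f differentiable (at x)) \<and>
     (\<forall>v. Ck_on k S (\<lambda>x. frechet_derivative f (at x) v))"

definition smooth_on :: "'a set \<Rightarrow> ('a::euclidean_space \<Rightarrow> 'b::euclidean_space) \<Rightarrow> bool" where
  "smooth_on S f \<longleftrightarrow> (\<forall>k. Ck_on k S f)"


section \<open>Smooth manifolds\<close>

text \<open>A chart is a pair \<open>(U, c)\<close> of an open set and a map whose values off \<open>U\<close> are irrelevant.
  The topology is a value rather than a type class instance: an immersed subgroup carries its own
  topology, in general finer than the subspace topology.\<close>

record ('a, 'e) mfd =
  mtop :: "'a topology"
  charts :: "('a set \<times> ('a \<Rightarrow> 'e)) set"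

definition smooth_manifold :: "('a, 'e::euclidean_space) mfd \<Rightarrow> bool" where
  "smooth_manifold M \<longleftrightarrow>
     Hausdorff_space (mtop M) \<and> second_countable (mtop M) \<and>
     topspace (mtop M) = (\<Union>(U, c)\<in>charts M. U) \<and>
     (\<forall>(U, c)\<in>charts M.
        openin (mtop M) U \<and> open (c ` U) \<and>
        homeomorphic_map (subtopology (mtop M) U) (top_of_set (c ` U)) c) \<and>
     (\<forall>(U, c)\<in>charts M. \<forall>(V, d)\<in>charts M.
        smooth_on (c ` (U \<inter> V)) (d \<circ> inv_into U c))"

definition interval_mfd :: "real set \<Rightarrow> (real, real) mfd" where
  "interval_mfd I = \<lparr>mtop = top_of_set I, charts = {(I, id)}\<rparr>"

definition prod_mfd ::
  "('a, 'e::euclidean_space) mfd \<Rightarrow> ('b, 'f::euclidean_space) mfd \<Rightarrow> ('a \<times> 'b, 'e \<times> 'f) mfd" where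
  "prod_mfd M N =
     \<lparr>mtop = prod_topology (mtop M) (mtop N),
      charts = (\<lambda>((U, c), (V, d)). (U \<times> V, map_prod c d)) ` (charts M \<times> charts N)\<rparr>"

definition smooth_map ::
  "('a, 'e::euclidean_space) mfd \<Rightarrow> ('b, 'f::euclidean_space) mfd \<Rightarrow> ('a \<Rightarrow> 'b) \<Rightarrow> bool" where
  "smooth_map M N F \<longleftrightarrow>
     continuous_map (mtop M) (mtop N) F \<and>
     (\<forall>(U, c)\<in>charts M. \<forall>(V, d)\<in>charts N.
        smooth_on (c ` (U \<inter> F -` V)) (d \<circ> F \<circ> inv_into U c))"

definition smooth_fun_on :: "('a, 'e::euclidean_space) mfd \<Rightarrow> 'a set \<Rightarrow> ('a \<Rightarrow> real) \<Rightarrow> bool" where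
  "smooth_fun_on M W f \<longleftrightarrow>
     openin (mtop M) W \<and> (\<forall>(U, c)\<in>charts M. smooth_on (c ` (U \<inter> W)) (f \<circ> inv_into U c))"

definition smooth_near :: "('a, 'e::euclidean_space) mfd \<Rightarrow> 'a \<Rightarrow> ('a \<Rightarrow> real) \<Rightarrow> bool" where
  "smooth_near M p f \<longleftrightarrow> (\<exists>W. p \<in> W \<and> smooth_fun_on M W f)"


subsection \<open>Tangent vectors and vector fields\<close>

text \<open>A tangent vector at \<open>p\<close> is the velocity of a smooth curve, regarded as a directional
  derivative acting on the functions that are smooth near \<open>p\<close>. Its value on all other functions
  is set to 0, so that equality of tangent vectors is equality of functionals.\<close>

definition velocity ::
  "('a, 'e::euclidean_space) mfd \<Rightarrow> (real \<Rightarrow> 'a) \<Rightarrow> real \<Rightarrow> ('a \<Rightarrow> real) \<Rightarrow> real" where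
  "velocity M \<gamma> t = (\<lambda>f. if smooth_near M (\<gamma> t) f then deriv (\<lambda>s. f (\<gamma> s)) t else 0)"

definition tangent_space ::
  "('a, 'e::euclidean_space) mfd \<Rightarrow> 'a \<Rightarrow> (('a \<Rightarrow> real) \<Rightarrow> real) set" where
  "tangent_space M p =
     {velocity M \<gamma> 0 | \<gamma> \<epsilon>.
        \<epsilon> > 0 \<and> smooth_map (interval_mfd {-\<epsilon><..<\<epsilon>}) M \<gamma> \<and> \<gamma> 0 = p}"

definition pushforward ::
  "('b, 'f::euclidean_space) mfd \<Rightarrow> ('a \<Rightarrow> 'b) \<Rightarrow> 'a \<Rightarrow>
     (('a \<Rightarrow> real) \<Rightarrow> real) \<Rightarrow> (('b \<Rightarrow> real) \<Rightarrow> real)" where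
  "pushforward N F p v = (\<lambda>f. if smooth_near N (F p) f then v (f \<circ> F) else 0)"

definition smooth_vector_field ::
  "('a, 'e::euclidean_space) mfd \<Rightarrow> ('a \<Rightarrow> ('a \<Rightarrow> real) \<Rightarrow> real) \<Rightarrow> bool" where
  "smooth_vector_field M X \<longleftrightarrow>
     X \<in> (\<Pi>\<^sub>E p\<in>topspace (mtop M). tangent_space M p) \<and>
     (\<forall>W f. smooth_fun_on M W f \<longrightarrow> smooth_fun_on M W (\<lambda>p. X p f))"

definition vf_bracket ::
  "('a, 'e::euclidean_space) mfd \<Rightarrow> ('a \<Rightarrow> ('a \<Rightarrow> real) \<Rightarrow> real) \<Rightarrow>
     ('a \<Rightarrow> ('a \<Rightarrow> real) \<Rightarrow> real) \<Rightarrow> ('a \<Rightarrow> ('a \<Rightarrow> real) \<Rightarrow> real)" where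
  "vf_bracket M X Y =
     (\<lambda>p\<in>topspace (mtop M). \<lambda>f.
        if smooth_near M p f then X p (\<lambda>q. Y q f) - Y p (\<lambda>q. X q f) else 0)"


subsection \<open>Simply connected spaces\<close>

text \<open>The library's \<^const>\<open>simply_connected\<close> is restricted to subsets of a type of class
  \<^class>\<open>topological_space\<close>. The homotopies below are free homotopies of loops, as there.\<close>

definition simply_connected_space :: "'a topology \<Rightarrow> bool" where
  "simply_connected_space X \<longleftrightarrow>
     path_connected_space X \<and>
     (\<forall>p. pathin X p \<and> p 0 = p 1 \<longrightarrow>
        homotopic_with (\<lambda>r. r 0 = r 1) (top_of_set {0..1}) X p (\<lambda>_. p 0))"


section \<open>Lie groups\<close>

definition lie_group :: "('a, 'm) monoid_scheme \<Rightarrow> ('a, 'e::euclidean_space) mfd \<Rightarrow> bool" where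
  "lie_group G M \<longleftrightarrow>
     group G \<and> smooth_manifold M \<and> topspace (mtop M) = carrier G \<and>
     smooth_map (prod_mfd M M) M (\<lambda>(x, y). x \<otimes>\<^bsub>G\<^esub> y) \<and>
     smooth_map M M (\<lambda>x. inv\<^bsub>G\<^esub> x)"

text \<open>The Lie algebra is the space of left-invariant vector fields with bracket
  \<^const>\<open>vf_bracket\<close>.\<close>

definition lie_algebra ::
  "('a, 'm) monoid_scheme \<Rightarrow> ('a, 'e::euclidean_space) mfd \<Rightarrow>
     ('a \<Rightarrow> ('a \<Rightarrow> real) \<Rightarrow> real) set" where
  "lie_algebra G M =
     {X. smooth_vector_field M X \<and>
         (\<forall>g\<in>carrier G. \<forall>h\<in>carrier G.
            X (g \<otimes>\<^bsub>G\<^esub> h) = pushforward M (\<lambda>x. g \<otimes>\<^bsub>G\<^esub> x) h (X h))}"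

text \<open>Isomorphisms from a Lie algebra, given by a subspace \<open>\<gg>\<close> of a real vector space and a
  bracket on it, onto the Lie algebra of \<open>G\<close>.\<close>

definition lie_algebra_iso ::
  "'v::real_vector set \<Rightarrow> ('v \<Rightarrow> 'v \<Rightarrow> 'v) \<Rightarrow>
     ('a, 'm) monoid_scheme \<Rightarrow> ('a, 'e::euclidean_space) mfd \<Rightarrow>
     ('v \<Rightarrow> ('a \<Rightarrow> ('a \<Rightarrow> real) \<Rightarrow> real)) \<Rightarrow> bool" where
  "lie_algebra_iso \<gg> br G M \<phi> \<longleftrightarrow>
     bij_betw \<phi> \<gg> (lie_algebra G M) \<and>
     (\<forall>X\<in>\<gg>. \<forall>Y\<in>\<gg>. \<forall>a b. \<forall>p\<in>carrier G. \<forall>f.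
        \<phi> (a *\<^sub>R X + b *\<^sub>R Y) p f = a * \<phi> X p f + b * \<phi> Y p f) \<and>
     (\<forall>X\<in>\<gg>. \<forall>Y\<in>\<gg>. \<phi> (br X Y) = vf_bracket M (\<phi> X) (\<phi> Y))"

text \<open>\<open>is_lie_exp G M X g\<close> says \<open>g = exp X\<close>, i.e. \<open>g = \<gamma> 1\<close> for the one-parameter subgroup \<open>\<gamma>\<close>
  with initial velocity \<open>X\<close> at the identity. It is stated as a relation because existence and
  uniqueness of \<open>\<gamma>\<close> are theorems.\<close>

definition is_lie_exp ::
  "('a, 'm) monoid_scheme \<Rightarrow> ('a, 'e::euclidean_space) mfd \<Rightarrow>
     ('a \<Rightarrow> ('a \<Rightarrow> real) \<Rightarrow> real) \<Rightarrow> 'a \<Rightarrow> bool" where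
  "is_lie_exp G M X g \<longleftrightarrow>
     (\<exists>\<gamma>. smooth_map (interval_mfd UNIV) M \<gamma> \<and>
          (\<forall>s t. \<gamma> (s + t) = \<gamma> s \<otimes>\<^bsub>G\<^esub> \<gamma> t) \<and>
          velocity M \<gamma> 0 = X \<one>\<^bsub>G\<^esub> \<and>
          \<gamma> 1 = g)"

text \<open>\<open>H\<close>, with a manifold structure \<open>MH\<close> of its own, is a connected (immersed) Lie subgroup of
  \<open>G\<close> whose Lie algebra, regarded as a subalgebra of the Lie algebra of \<open>G\<close>, is \<open>\<hh>\<close>.\<close>

definition connected_lie_subgroup ::
  "('a, 'm) monoid_scheme \<Rightarrow> ('a, 'e::euclidean_space) mfd \<Rightarrow>
     ('a \<Rightarrow> ('a \<Rightarrow> real) \<Rightarrow> real) set \<Rightarrow>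
     'a set \<Rightarrow> ('a, 'f::euclidean_space) mfd \<Rightarrow> bool" where
  "connected_lie_subgroup G M \<hh> H MH \<longleftrightarrow>
     subgroup H G \<and> lie_group (G\<lparr>carrier := H\<rparr>) MH \<and> connected_space (mtop MH) \<and>
     smooth_map MH M id \<and>
     (\<forall>p\<in>H. inj_on (pushforward M id p) (tangent_space MH p)) \<and>
     {X \<in> lie_algebra G M.
        X \<one>\<^bsub>G\<^esub> \<in> pushforward M id \<one>\<^bsub>G\<^esub> ` tangent_space MH \<one>\<^bsub>G\<^esub>} = \<hh>"


section \<open>The split real Lie algebra of type \<open>G\<^sub>2\<close>\<close>

text \<open>An element \<open>x + A + \<xi>\<close> of \<open>V \<oplus> gl(V) \<oplus> V\<^sup>*\<close> with \<open>V = \<real>\<^sup>3\<close> is the triple \<open>(x, A, \<xi>)\<close>, where \<open>\<xi>\<close> is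
  given by its coordinates in the dual basis; hence \<open>\<xi>(x) = \<xi> \<bullet> x\<close>, the matrix \<open>A\<close> acts on \<open>V\<^sup>*\<close> by
  minus its transpose, and \<open>det(x, y, \<cdot>)\<close> and \<open>det\<^sup>-\<^sup>1(\<xi>, \<eta>, \<cdot>)\<close> are cross products of coordinate
  vectors.\<close>

type_synonym g2_elt = "(real^3) \<times> (real^3^3) \<times> (real^3)"

definition g2_carrier :: "g2_elt set" where
  "g2_carrier = {(x, A, \<xi>). trace A = 0}"

definition tensor3 :: "real^3 \<Rightarrow> real^3 \<Rightarrow> real^3^3" where
  "tensor3 x \<xi> = (\<chi> i j. x $ i * \<xi> $ j)"

definition sl_part :: "real^3 \<Rightarrow> real^3 \<Rightarrow> real^3^3" where
  "sl_part x \<xi> = 3 *\<^sub>R tensor3 x \<xi> - (\<xi> \<bullet> x) *\<^sub>R mat 1"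

fun g2_bracket :: "g2_elt \<Rightarrow> g2_elt \<Rightarrow> g2_elt" where
  "g2_bracket (x, A, \<xi>) (y, B, \<eta>) =
     (A *v y - B *v x + 2 *\<^sub>R cross3 \<xi> \<eta>,
      A ** B - B ** A + sl_part x \<eta> - sl_part y \<xi>,
      - (transpose A *v \<eta>) + transpose B *v \<xi> - 2 *\<^sub>R cross3 x y)"

text \<open>\<open>e_up i\<close>, \<open>e_dn i\<close> and \<open>e_mat i j\<close> are \<open>e\<^sup>i \<in> V\<^sup>*\<close>, \<open>e\<^sub>i \<in> V\<close> and \<open>e\<^sub>i \<otimes> e\<^sup>j \<in> gl(V)\<close>.\<close>

definition e_dn :: "3 \<Rightarrow> g2_elt" where
  "e_dn i = (axis i 1, 0, 0)"

definition e_up :: "3 \<Rightarrow> g2_elt" where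
  "e_up i = (0, 0, axis i 1)"

definition e_mat :: "3 \<Rightarrow> 3 \<Rightarrow> g2_elt" where
  "e_mat i j = (0, tensor3 (axis i 1) (axis j 1), 0)"

definition cartan :: "g2_elt set" where
  "cartan = {\<Sum>i\<in>UNIV. c i *\<^sub>R e_mat i i | c :: 3 \<Rightarrow> real. (\<Sum>i\<in>UNIV. c i) = 0}"

definition g2_ev :: "g2_elt set" where
  "g2_ev = span (cartan \<union> {e_dn 3, e_up 3, e_mat 1 2, e_mat 2 1})"

definition g2_l :: "g2_elt set" where
  "g2_l = span (cartan \<union> {e_dn 1, e_up 2, e_up 3, e_mat 1 2, e_mat 1 3, e_mat 2 3})"

end

theory Submission
  imports Defs
begin

text \<open>Let \<open>v = e_mat 1 3\<close>, a highest root vector. The connected group \<open>L\<close> preserves the line of \<open>v\<close>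
  under \<open>Ad\<close>. The component of an element of \<open>\<gg>\<close> in the first simple ideal of \<open>\<gg>\<^sub>e\<^sub>v\<close>, the span of
  \<open>e\<^sub>1\<^sup>2\<close>, \<open>e\<^sub>2\<^sup>1\<close> and \<open>e\<^sub>1\<^sup>1 - e\<^sub>2\<^sup>2\<close>, is equivariant under \<open>G\<^sub>e\<^sub>v\<close>, so \<open>Q = - det\<close> of that component
  is a \<open>G\<^sub>e\<^sub>v\<close>-invariant quadratic form. The exponential series give
  \<open>Q (Ad a' v) = 1 / 4\<close> and \<open>Q (Ad a'' v) = - 1\<close>. A common point of the two orbits would give
  \<open>Ad a'' (s v) = Ad h (Ad a' (t v))\<close> with \<open>h\<close> in \<open>G\<^sub>e\<^sub>v\<close> and nonzero \<open>s\<close>, \<open>t\<close>, against the signs of \<open>Q\<close>.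

  Both invariance statements are proved by differentiation: a function on a connected Lie subgroup
  \<open>H\<close> whose derivatives along the left translates of its Lie algebra vanish is constant, and the
  derivative of \<open>Ad\<close> at the identity is the bracket.\<close>

section \<open>Calculus of smooth maps\<close>

text \<open>Elements of \<open>L\<close> rescale \<open>v\<close> by unknown factors, so of the
  value of a quadratic form only the sign can be compared; this is why the form has to be
  indefinite. \<open>Q\<close> is, up to a positive factor, the Killing form of the ideal. Its two
  values say that the component of \<open>Ad a' v\<close> is hyperbolic and that of
  \<open>Ad a'' v\<close> is elliptic. The shape of the proof is dictated by the definitions.
  Tangent vectors are functionals on functions, the Lie algebra consists of vector fields, and a
  connected subgroup carries its own, possibly finer, topology. The tangent space at the identity is
  therefore read in one chart, where multiplication is a map between Euclidean spaces. Bracket and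
  \<open>Ad\<close> become derivatives of that map, and connectedness is used only in the manifold
  structure of the subgroup itself. Exponentials occur only for \<open>a'\<close> and
  \<open>a''\<close>, whose logarithms annihilate \<open>v\<close> after finitely many brackets, so
  no convergence is involved.\<close>

lemma Ck_on_subset: "Ck_on k S f \<Longrightarrow> T \<subseteq> S \<Longrightarrow> Ck_on k T f"
  by (induction k arbitrary: f) (auto intro: continuous_on_subset)

lemma frechet_derivative_cong_open:
  assumes "open S" "x \<in> S" "\<And>y. y \<in> S \<Longrightarrow> f y = g y"
  shows "frechet_derivative f (at x) = frechet_derivative g (at x)"
proof -
  have "(f has_derivative D) (at x) \<longleftrightarrow> (g has_derivative D) (at x)" for D
    using assms by (metis has_derivative_transform_within_open)
  then show ?thesis by (simp add: frechet_derivative_def)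
qed

lemma differentiable_cong_open:
  assumes "open S" "x \<in> S" "\<And>y. y \<in> S \<Longrightarrow> f y = g y" "f differentiable (at x)"
  shows "g differentiable (at x)"
  using assms by (metis differentiable_def has_derivative_transform_within_open)

lemma Ck_on_cong:
  assumes "open S" "\<And>x. x \<in> S \<Longrightarrow> f x = g x" "Ck_on k S f"
  shows "Ck_on k S g"
  using assms(2,3)
proof (induction k arbitrary: f g)
  case 0
  then show ?case by (metis Ck_on.simps(1) continuous_on_cong)
next
  case (Suc k)
  have "Ck_on k S (\<lambda>x. frechet_derivative g (at x) v)" for v
  proof (rule Suc.IH)
    show "Ck_on k S (\<lambda>x. frechet_derivative f (at x) v)" using Suc.prems by simp
    show "frechet_derivative f (at x) v = frechet_derivative g (at x) v" if "x \<in> S" for x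
      using frechet_derivative_cong_open[OF assms(1) that, of f g] Suc.prems(1) by simp
  qed
  moreover have "g differentiable (at x)" if "x \<in> S" for x
    using differentiable_cong_open[OF assms(1) that, of f g] Suc.prems that by simp
  ultimately show ?case by simp
qed

text \<open>Derivatives in \<open>Ck_on\<close> are taken \<open>at x\<close> in the whole space, so
  the property can be tested on open neighbourhoods. This glues the pieces when the image of a map
  is not covered by a single chart.\<close>

lemma Ck_on_locally:
  assumes "\<And>x. x \<in> S \<Longrightarrow> \<exists>T. open T \<and> x \<in> T \<and> Ck_on k T f"
  shows "Ck_on k S f"
  using assms
proof (induction k arbitrary: f)
  case 0
  show ?case unfolding Ck_on.simps(1)
  proof (rule continuous_at_imp_continuous_on, rule ballI)
    fix x assume "x \<in> S"
    then show "isCont f x" using 0 by (metis Ck_on.simps(1) continuous_on_eq_continuous_at)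
  qed
next
  case (Suc k)
  have "Ck_on k S (\<lambda>x. frechet_derivative f (at x) v)" for v
  proof (rule Suc.IH)
    fix x assume "x \<in> S"
    from Suc.prems[OF this] obtain T where "open T" "x \<in> T" "Ck_on (Suc k) T f" by blast
    then show "\<exists>T. open T \<and> x \<in> T \<and> Ck_on k T (\<lambda>x. frechet_derivative f (at x) v)"
      by auto
  qed
  moreover have "f differentiable (at x)" if "x \<in> S" for x
    using Suc.prems[OF that] by auto
  ultimately show ?case by simp
qed

lemma Ck_on_Suc_imp: "Ck_on (Suc k) S f \<Longrightarrow> Ck_on k S f"
proof (induction k arbitrary: f)
  case 0
  then show ?case
    by (simp add: continuous_at_imp_continuous_on differentiable_imp_continuous_within)
qed simp

lemma Ck_on_has_derivative:
  assumes "Ck_on (Suc k) S f" "x \<in> S"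
  shows "(f has_derivative frechet_derivative f (at x)) (at x)"
  using assms frechet_derivative_works by auto

text \<open>Uniqueness of derivatives lets an explicit formula stand in for
  \<open>frechet_derivative\<close>. The rules for sums, products and composites below are
  inductions whose step is this rule.\<close>

lemma Ck_on_SucI:
  assumes "open S" "\<And>x. x \<in> S \<Longrightarrow> (f has_derivative f' x) (at x)"
    and "\<And>v. Ck_on k S (\<lambda>x. f' x v)"
  shows "Ck_on (Suc k) S f"
proof -
  have "frechet_derivative f (at x) = f' x" if "x \<in> S" for x
    using assms(2)[OF that] by (metis frechet_derivative_at)
  then have "Ck_on k S (\<lambda>x. frechet_derivative f (at x) v)" for v
    using Ck_on_cong[OF assms(1) _ assms(3)[of v], of "\<lambda>x. frechet_derivative f (at x) v"] by simp
  moreover have "f differentiable (at x)" if "x \<in> S" for x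
    using assms(2)[OF that] by (auto simp: differentiable_def)
  ultimately show ?thesis by simp
qed

lemma Ck_on_const: "open S \<Longrightarrow> Ck_on k S (\<lambda>x. c)"
proof (induction k arbitrary: c)
  case (Suc k)
  show ?case by (rule Ck_on_SucI[where f' = "\<lambda>x v. 0"]) (use Suc in auto)
qed simp

lemma Ck_on_bounded_linear:
  assumes "open S" "bounded_linear L" shows "Ck_on k S L"
proof (cases k)
  case 0
  then show ?thesis using assms by (simp add: linear_continuous_on)
next
  case (Suc j)
  show ?thesis unfolding Suc
    by (rule Ck_on_SucI[where f' = "\<lambda>x. L"])
       (use assms in \<open>auto intro: bounded_linear_imp_has_derivative Ck_on_const\<close>)
qed

lemma Ck_on_linear_compose:
  assumes "open S" "bounded_linear L" "Ck_on k S f" shows "Ck_on k S (\<lambda>x. L (f x))"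
  using assms(3)
proof (induction k arbitrary: f)
  case 0
  then show ?case using assms(2) by (simp add: bounded_linear.continuous_on)
next
  case (Suc k)
  show ?case
  proof (rule Ck_on_SucI[where f' = "\<lambda>x v. L (frechet_derivative f (at x) v)"])
    show "((\<lambda>x. L (f x)) has_derivative (\<lambda>v. L (frechet_derivative f (at x) v))) (at x)"
      if "x \<in> S" for x
      using bounded_linear.has_derivative[OF assms(2) Ck_on_has_derivative[OF Suc.prems that]] .
    show "Ck_on k S (\<lambda>x. L (frechet_derivative f (at x) v))" for v
      by (rule Suc.IH) (use Suc.prems in simp)
  qed fact
qed

lemma Ck_on_add:
  assumes "open S" "Ck_on k S f" "Ck_on k S g" shows "Ck_on k S (\<lambda>x. f x + g x)"
  using assms(2,3)
proof (induction k arbitrary: f g)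
  case 0
  then show ?case by (simp add: continuous_on_add)
next
  case (Suc k)
  show ?case
  proof (rule Ck_on_SucI[where f' = "\<lambda>x v. frechet_derivative f (at x) v + frechet_derivative g (at x) v"])
    show "((\<lambda>x. f x + g x) has_derivative
        (\<lambda>v. frechet_derivative f (at x) v + frechet_derivative g (at x) v)) (at x)" if "x \<in> S" for x
      by (intro has_derivative_add Ck_on_has_derivative[where k = k, OF _ that] Suc.prems)
    show "Ck_on k S (\<lambda>x. frechet_derivative f (at x) v + frechet_derivative g (at x) v)" for v
      by (rule Suc.IH) (use Suc.prems in simp_all)
  qed fact
qed

lemma Ck_on_scaleR:
  fixes f :: "'a::euclidean_space \<Rightarrow> real"
  assumes "open S" "Ck_on k S f" "Ck_on k S g" shows "Ck_on k S (\<lambda>x. f x *\<^sub>R g x)"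
  using assms(2,3)
proof (induction k arbitrary: f g)
  case 0
  then show ?case by (simp add: continuous_on_scaleR)
next
  case (Suc k)
  show ?case
  proof (rule Ck_on_SucI[where f' = "\<lambda>x v. f x *\<^sub>R frechet_derivative g (at x) v + frechet_derivative f (at x) v *\<^sub>R g x"])
    show "((\<lambda>x. f x *\<^sub>R g x) has_derivative
        (\<lambda>v. f x *\<^sub>R frechet_derivative g (at x) v + frechet_derivative f (at x) v *\<^sub>R g x)) (at x)"
      if "x \<in> S" for x
      by (intro has_derivative_scaleR Ck_on_has_derivative[where k = k, OF _ that] Suc.prems)
    show "Ck_on k S (\<lambda>x. f x *\<^sub>R frechet_derivative g (at x) v + frechet_derivative f (at x) v *\<^sub>R g x)" for v
    proof (intro Ck_on_add Suc.IH)
      show "Ck_on k S f" "Ck_on k S g" using Suc.prems by (auto intro: Ck_on_Suc_imp)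
    qed (use Suc.prems assms(1) in auto)
  qed fact
qed

lemma Ck_on_sum:
  assumes "open S" "\<And>i. i \<in> I \<Longrightarrow> Ck_on k S (f i)" shows "Ck_on k S (\<lambda>x. \<Sum>i\<in>I. f i x)"
proof (cases "finite I")
  case True
  then show ?thesis using assms(2)
  proof (induction I)
    case (insert i I)
    then show ?case using Ck_on_add[OF assms(1), of k "f i" "\<lambda>x. \<Sum>i\<in>I. f i x"] by simp
  qed (simp add: Ck_on_const assms(1))
qed (simp add: Ck_on_const assms(1))

lemma linear_basis_sum:
  fixes L :: "'a::euclidean_space \<Rightarrow> 'b::real_vector"
  assumes "linear L" shows "L v = (\<Sum>b\<in>Basis. (v \<bullet> b) *\<^sub>R L b)"
proof -
  have "L v = L (\<Sum>b\<in>Basis. (v \<bullet> b) *\<^sub>R b)" by (simp add: euclidean_representation)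
  also have "\<dots> = (\<Sum>b\<in>Basis. (v \<bullet> b) *\<^sub>R L b)"
    using assms by (simp add: linear_sum linear_cmul)
  finally show ?thesis .
qed

text \<open>In the chain rule \<open>x\<close> enters both through the base point of the outer
  derivative and through its argument, whereas \<open>Ck_on\<close> speaks of derivatives in a fixed
  direction. Expanding the argument in the basis leaves scalar functions times
  \<open>frechet_derivative g (at (f x)) b\<close> with fixed \<open>b\<close>, to which the
  induction hypothesis applies.\<close>

lemma Ck_on_compose:
  assumes "open S" "open T" "Ck_on k S f" "Ck_on k T g" "f ` S \<subseteq> T"
  shows "Ck_on k S (\<lambda>x. g (f x))"
  using assms(3,4,5)
proof (induction k arbitrary: f g)
  case 0
  then show ?case by (simp add: continuous_on_compose2)
next
  case (Suc k)
  let ?f = "\<lambda>x. frechet_derivative f (at x)" and ?g = "\<lambda>x. frechet_derivative g (at x)"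
  have g: "(g has_derivative ?g (f x)) (at (f x))" if "x \<in> S" for x
    using Ck_on_has_derivative[OF Suc.prems(2)] that Suc.prems(3) by auto
  have f: "(f has_derivative ?f x) (at x)" if "x \<in> S" for x
    using Ck_on_has_derivative[OF Suc.prems(1)] that by auto
  show ?case
  proof (rule Ck_on_SucI[where f' = "\<lambda>x v. \<Sum>b\<in>Basis. (?f x v \<bullet> b) *\<^sub>R ?g (f x) b"])
    show "((\<lambda>x. g (f x)) has_derivative (\<lambda>v. \<Sum>b\<in>Basis. (?f x v \<bullet> b) *\<^sub>R ?g (f x) b)) (at x)"
      if "x \<in> S" for x
      by (rule has_derivative_eq_rhs[OF has_derivative_compose[OF f[OF that] g[OF that]]], rule ext,
          rule linear_basis_sum[OF has_derivative_linear[OF g[OF that]]])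
    have "Ck_on k S f" using Suc.prems(1) by (rule Ck_on_Suc_imp)
    moreover have f': "Ck_on k S (\<lambda>x. ?f x v)" and "Ck_on k T (\<lambda>x. ?g x b)" for v b
      using Suc.prems by simp_all
    ultimately have "Ck_on k S (\<lambda>x. ?g (f x) b)" for b
      using Suc.IH[OF _ _ Suc.prems(3), of "\<lambda>x. ?g x b"] by blast
    then show "Ck_on k S (\<lambda>x. \<Sum>b\<in>Basis. (?f x v \<bullet> b) *\<^sub>R ?g (f x) b)" for v
      by (intro Ck_on_sum[OF assms(1)] Ck_on_scaleR[OF assms(1)]
            Ck_on_linear_compose[OF assms(1) bounded_linear_inner_left f'])
  qed fact
qed

lemma smooth_on_subset: "smooth_on S f \<Longrightarrow> T \<subseteq> S \<Longrightarrow> smooth_on T f"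
  by (auto simp: smooth_on_def intro: Ck_on_subset)

lemma smooth_on_cong:
  assumes "open S" "\<And>x. x \<in> S \<Longrightarrow> f x = g x" "smooth_on S f"
  shows "smooth_on S g"
  unfolding smooth_on_def
proof
  show "Ck_on k S g" for k
    by (rule Ck_on_cong[OF assms(1,2)]) (use assms(3) in \<open>simp_all add: smooth_on_def\<close>)
qed

lemma smooth_on_locally:
  assumes "\<And>x. x \<in> S \<Longrightarrow> \<exists>T. open T \<and> x \<in> T \<and> smooth_on T f"
  shows "smooth_on S f"
  unfolding smooth_on_def
proof
  show "Ck_on k S f" for k
  proof (rule Ck_on_locally)
    fix x assume "x \<in> S"
    from assms[OF this] obtain T where "open T" "x \<in> T" "smooth_on T f" by blast
    then show "\<exists>T. open T \<and> x \<in> T \<and> Ck_on k T f" by (auto simp: smooth_on_def)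
  qed
qed

lemma smooth_on_const: "open S \<Longrightarrow> smooth_on S (\<lambda>x. c)"
  by (simp add: smooth_on_def Ck_on_const)

lemma smooth_on_bounded_linear: "open S \<Longrightarrow> bounded_linear L \<Longrightarrow> smooth_on S L"
  by (simp add: smooth_on_def Ck_on_bounded_linear)

lemma smooth_on_ident: "open S \<Longrightarrow> smooth_on S (\<lambda>x. x)"
  by (rule smooth_on_bounded_linear[OF _ bounded_linear_ident])

lemma smooth_on_compose:
  assumes "open S" "open T" "smooth_on S f" "smooth_on T g" "f ` S \<subseteq> T"
  shows "smooth_on S (\<lambda>x. g (f x))"
  unfolding smooth_on_def
proof
  show "Ck_on k S (\<lambda>x. g (f x))" for k
    by (rule Ck_on_compose[OF assms(1,2) _ _ assms(5)]) (use assms(3,4) in \<open>simp_all add: smooth_on_def\<close>)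
qed

lemma smooth_on_linear_compose:
  assumes "open S" "bounded_linear L" "smooth_on S f" shows "smooth_on S (\<lambda>x. L (f x))"
  by (rule smooth_on_compose[OF assms(1) open_UNIV assms(3)])
     (simp_all add: smooth_on_bounded_linear assms)

lemma smooth_on_add:
  assumes "open S" "smooth_on S f" "smooth_on S g" shows "smooth_on S (\<lambda>x. f x + g x)"
  unfolding smooth_on_def
proof
  show "Ck_on k S (\<lambda>x. f x + g x)" for k
    by (rule Ck_on_add[OF assms(1)]) (use assms(2,3) in \<open>simp_all add: smooth_on_def\<close>)
qed

lemma smooth_on_Pair:
  assumes "open S" "smooth_on S f" "smooth_on S g" shows "smooth_on S (\<lambda>x. (f x, g x))"
proof -
  have L: "bounded_linear (\<lambda>u::'b. (u, 0::'c))" "bounded_linear (\<lambda>u::'c. (0::'b, u))"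
    by (intro bounded_linear_Pair bounded_linear_ident bounded_linear_zero)+
  have "smooth_on S (\<lambda>x. (f x, 0) + (0, g x))"
    by (rule smooth_on_add[OF assms(1) smooth_on_linear_compose[OF assms(1) L(1) assms(2)]
          smooth_on_linear_compose[OF assms(1) L(2) assms(3)]])
  then show ?thesis by simp
qed

lemma smooth_on_imp_Ck_on: "smooth_on S f \<Longrightarrow> Ck_on k S f"
  by (simp add: smooth_on_def)

lemma smooth_on_has_derivative:
  "smooth_on S f \<Longrightarrow> x \<in> S \<Longrightarrow> (f has_derivative frechet_derivative f (at x)) (at x)"
  by (rule Ck_on_has_derivative[OF smooth_on_imp_Ck_on[where k = "Suc 0"]])

lemma smooth_on_differentiable: "smooth_on S f \<Longrightarrow> x \<in> S \<Longrightarrow> f differentiable (at x)"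
  using smooth_on_has_derivative unfolding differentiable_def by blast

lemma smooth_on_continuous_on: "smooth_on S f \<Longrightarrow> continuous_on S f"
  by (drule smooth_on_imp_Ck_on[where k = 0]) simp

lemma smooth_on_frechet_derivative:
  assumes "smooth_on S f" shows "smooth_on S (\<lambda>x. frechet_derivative f (at x) v)"
  unfolding smooth_on_def
proof
  show "Ck_on k S (\<lambda>x. frechet_derivative f (at x) v)" for k
    using smooth_on_imp_Ck_on[OF assms, of "Suc k"] by simp
qed

lemma smooth_on_frechet_derivative_compose:
  assumes "open S" "open T" "smooth_on T f" "smooth_on S p" "p ` S \<subseteq> T"
  shows "smooth_on S (\<lambda>x. frechet_derivative f (at (p x)) v)"
  by (rule smooth_on_compose[OF assms(1,2,4) smooth_on_frechet_derivative[OF assms(3)] assms(5)])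

lemma has_derivative_local_ident:
  assumes "(f has_derivative f') (at x)" "open S" "x \<in> S" "\<And>y. y \<in> S \<Longrightarrow> f y = y"
  shows "f' v = v"
proof -
  have "((\<lambda>y. y) has_derivative f') (at x)"
    by (rule has_derivative_transform_within_open[OF assms(1-3)]) (rule assms(4))
  then have "f' = (\<lambda>v. v)" using has_derivative_ident by (rule has_derivative_unique)
  then show ?thesis by simp
qed

lemma has_derivative_local_const:
  assumes "(f has_derivative f') (at x)" "open S" "x \<in> S" "\<And>y. y \<in> S \<Longrightarrow> f y = a"
  shows "f' v = 0"
proof -
  have "((\<lambda>y. a) has_derivative f') (at x)"
    by (rule has_derivative_transform_within_open[OF assms(1-3)]) (rule assms(4))
  then have "f' = (\<lambda>v. 0)" using has_derivative_const by (rule has_derivative_unique)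
  then show ?thesis by simp
qed

section \<open>Symmetry of second derivatives\<close>

lemma second_difference_mean_value:
  fixes g :: "'a::euclidean_space \<Rightarrow> real"
  assumes sm: "smooth_on S g" and "ball p r \<subseteq> S" and s: "0 < s" "s * (norm u + norm v) < r"
  shows "\<exists>q. dist p q \<le> s * (norm u + norm v) \<and>
    g (p + s *\<^sub>R u + s *\<^sub>R v) - g (p + s *\<^sub>R u) - g (p + s *\<^sub>R v) + g p =
    s * s * frechet_derivative (\<lambda>x. frechet_derivative g (at x) u) (at q) v"
proof -
  let ?D = "\<lambda>x. frechet_derivative g (at x) u"
  have small: "norm (a *\<^sub>R u + b *\<^sub>R v) \<le> s * (norm u + norm v)" if "0 \<le> a" "a \<le> s" "0 \<le> b" "b \<le> s" for a b
  proof -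
    have "norm (a *\<^sub>R u + b *\<^sub>R v) \<le> a * norm u + b * norm v"
      using norm_triangle_ineq[of "a *\<^sub>R u" "b *\<^sub>R v"] that by simp
    also have "\<dots> \<le> s * norm u + s * norm v"
      using that by (intro add_mono mult_right_mono) auto
    finally show ?thesis by (simp add: algebra_simps)
  qed
  have inS: "p + a *\<^sub>R u + b *\<^sub>R v \<in> S" if "0 \<le> a" "a \<le> s" "0 \<le> b" "b \<le> s" for a b
  proof -
    have "dist p (p + a *\<^sub>R u + b *\<^sub>R v) = norm (a *\<^sub>R u + b *\<^sub>R v)"
      by (metis add.assoc add_diff_cancel_left' dist_commute dist_norm)
    then show ?thesis using small[OF that] s(2) assms(2) by auto
  qed
  have lin: "frechet_derivative h (at x) (c *\<^sub>R w) = c * frechet_derivative h (at x) w"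
    if "(h has_derivative frechet_derivative h (at x)) (at x)" for h :: "'a \<Rightarrow> real" and x c w
    using has_derivative_linear[OF that] by (simp add: linear_cmul)
  have d1: "((\<lambda>a. g (p + a *\<^sub>R u + b *\<^sub>R v)) has_real_derivative ?D (p + a *\<^sub>R u + b *\<^sub>R v)) (at a)"
    if "0 \<le> a" "a \<le> s" "0 \<le> b" "b \<le> s" for a b
  proof -
    note g = smooth_on_has_derivative[OF sm inS[OF that]]
    have "((\<lambda>a. p + a *\<^sub>R u + b *\<^sub>R v) has_derivative (\<lambda>h. h *\<^sub>R u)) (at a)"
      by (auto intro!: derivative_eq_intros)
    from has_derivative_compose[OF this g] show ?thesis
      unfolding has_field_derivative_def
      by (rule has_derivative_eq_rhs) (simp add: lin[OF g] fun_eq_iff)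
  qed
  \<comment> \<open>The second difference is the increment in direction \<open>u\<close> of a
    function that is itself the increment of \<open>g\<close> by \<open>s *\<^sub>R v\<close>. A
    second mean value, in direction \<open>v\<close>, then treats the remaining difference of
    derivatives.\<close>
  have "\<exists>a. 0 < a \<and> a < s \<and>
    (g (p + s *\<^sub>R u + s *\<^sub>R v) - g (p + s *\<^sub>R u + 0 *\<^sub>R v)) - (g (p + 0 *\<^sub>R u + s *\<^sub>R v) - g (p + 0 *\<^sub>R u + 0 *\<^sub>R v))
     = (s - 0) * (?D (p + a *\<^sub>R u + s *\<^sub>R v) - ?D (p + a *\<^sub>R u + 0 *\<^sub>R v))"
  proof (rule MVT2[OF s(1)])
    fix a assume "0 \<le> a" "a \<le> s"
    with s show "((\<lambda>a. g (p + a *\<^sub>R u + s *\<^sub>R v) - g (p + a *\<^sub>R u + 0 *\<^sub>R v)) has_real_derivative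
        ?D (p + a *\<^sub>R u + s *\<^sub>R v) - ?D (p + a *\<^sub>R u + 0 *\<^sub>R v)) (at a)"
      by (intro DERIV_diff d1) simp_all
  qed
  then obtain a where a: "0 < a" "a < s" and
    aeq: "g (p + s *\<^sub>R u + s *\<^sub>R v) - g (p + s *\<^sub>R u) - g (p + s *\<^sub>R v) + g p
     = s * (?D (p + a *\<^sub>R u + s *\<^sub>R v) - ?D (p + a *\<^sub>R u))" by auto
  note sm' = smooth_on_frechet_derivative[OF sm, of u]
  have d2: "((\<lambda>b. ?D (p + a *\<^sub>R u + b *\<^sub>R v)) has_real_derivative
      frechet_derivative ?D (at (p + a *\<^sub>R u + b *\<^sub>R v)) v) (at b)" if "0 \<le> b" "b \<le> s" for b
  proof -
    have "p + a *\<^sub>R u + b *\<^sub>R v \<in> S" using inS a that by simp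
    note g = smooth_on_has_derivative[OF sm' this]
    have "((\<lambda>b. p + a *\<^sub>R u + b *\<^sub>R v) has_derivative (\<lambda>h. h *\<^sub>R v)) (at b)"
      by (auto intro!: derivative_eq_intros)
    from has_derivative_compose[OF this g] show ?thesis
      unfolding has_field_derivative_def
      by (rule has_derivative_eq_rhs) (simp add: lin[OF g] fun_eq_iff)
  qed
  have "\<exists>b. 0 < b \<and> b < s \<and> ?D (p + a *\<^sub>R u + s *\<^sub>R v) - ?D (p + a *\<^sub>R u + 0 *\<^sub>R v)
     = (s - 0) * frechet_derivative ?D (at (p + a *\<^sub>R u + b *\<^sub>R v)) v"
    by (rule MVT2[OF s(1)]) (use d2 in auto)
  then obtain b where b: "0 < b" "b < s" and
    beq: "?D (p + a *\<^sub>R u + s *\<^sub>R v) - ?D (p + a *\<^sub>R u)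
     = s * frechet_derivative ?D (at (p + a *\<^sub>R u + b *\<^sub>R v)) v" by auto
  show ?thesis
  proof (intro exI conjI)
    show "dist p (p + a *\<^sub>R u + b *\<^sub>R v) \<le> s * (norm u + norm v)"
    proof -
      have "dist p (p + a *\<^sub>R u + b *\<^sub>R v) = norm (a *\<^sub>R u + b *\<^sub>R v)"
        by (metis add.assoc add_diff_cancel_left' dist_commute dist_norm)
      then show ?thesis using small[of a b] a b by simp
    qed
    show "g (p + s *\<^sub>R u + s *\<^sub>R v) - g (p + s *\<^sub>R u) - g (p + s *\<^sub>R v) + g p =
      s * s * frechet_derivative ?D (at (p + a *\<^sub>R u + b *\<^sub>R v)) v"
      by (simp only: aeq beq mult.assoc)
  qed
qed

text \<open>The second difference is symmetric in \<open>u\<close> and \<open>v\<close>, so divided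
  by \<open>s * s\<close> it is a value of either mixed derivative at a point near \<open>p\<close>.
  If the two values at \<open>p\<close> differed, continuity would keep the mixed derivatives apart
  near \<open>p\<close>.\<close>

lemma second_derivative_symmetric_real:
  fixes g :: "'a::euclidean_space \<Rightarrow> real"
  assumes "open S" and sm: "smooth_on S g" and "p \<in> S"
  shows "frechet_derivative (\<lambda>x. frechet_derivative g (at x) u) (at p) v =
         frechet_derivative (\<lambda>x. frechet_derivative g (at x) v) (at p) u"
    (is "?A p = ?B p")
proof (rule ccontr)
  assume ne: "?A p \<noteq> ?B p"
  define e where "e = \<bar>?A p - ?B p\<bar> / 2"
  have e: "e > 0" using ne by (simp add: e_def)
  have "continuous_on S ?A" "continuous_on S ?B"
    by (intro smooth_on_continuous_on smooth_on_frechet_derivative sm)+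
  then have "isCont ?A p" "isCont ?B p"
    using assms by (auto simp: continuous_on_eq_continuous_at)
  then have "\<exists>d>0. \<forall>q. dist q p < d \<longrightarrow> dist (?A q) (?A p) < e"
    "\<exists>d>0. \<forall>q. dist q p < d \<longrightarrow> dist (?B q) (?B p) < e"
    using e unfolding continuous_at_eps_delta by blast+
  then obtain d1 d2 where d: "d1 > 0" "d2 > 0"
    "\<And>q. dist q p < d1 \<Longrightarrow> dist (?A q) (?A p) < e" "\<And>q. dist q p < d2 \<Longrightarrow> dist (?B q) (?B p) < e"
    by blast
  obtain r where r: "r > 0" "ball p r \<subseteq> S" using assms openE by blast
  define m where "m = min r (min d1 d2)"
  \<comment> \<open>The summand 1 keeps \<open>N\<close> positive when \<open>u\<close> and
    \<open>v\<close> vanish. With this \<open>s\<close> both intermediate points lie within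
    \<open>m / 2\<close> of \<open>p\<close>.\<close>
  define N where "N = norm u + norm v + 1"
  define s where "s = m / (2 * N)"
  have m: "m > 0" using r d by (simp add: m_def)
  have N: "N > 0" by (simp add: N_def add_nonneg_pos)
  have s: "s > 0" using m N by (simp add: s_def)
  have "s * (norm u + norm v) \<le> s * N" using s by (simp add: N_def)
  also have "\<dots> = m / 2" using N by (simp add: s_def)
  also have "\<dots> < m" using m by simp
  finally have sm1: "s * (norm u + norm v) < m" .
  have "s * (norm u + norm v) < r" "s * (norm v + norm u) < r"
    using sm1 by (simp_all add: m_def add.commute)
  note B = this
  obtain q where q: "dist p q \<le> s * (norm u + norm v)"
    and eq: "g (p + s *\<^sub>R u + s *\<^sub>R v) - g (p + s *\<^sub>R u) - g (p + s *\<^sub>R v) + g p = s * s * ?A q"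
    using second_difference_mean_value[OF sm r(2) s B(1)] by (elim exE conjE)
  obtain q' where q': "dist p q' \<le> s * (norm v + norm u)"
    and eq': "g (p + s *\<^sub>R v + s *\<^sub>R u) - g (p + s *\<^sub>R v) - g (p + s *\<^sub>R u) + g p = s * s * ?B q'"
    using second_difference_mean_value[OF sm r(2) s B(2)] by (elim exE conjE)
  have c: "p + s *\<^sub>R v + s *\<^sub>R u = p + s *\<^sub>R u + s *\<^sub>R v" by (simp add: add_ac)
  then have "s * s * ?A q = s * s * ?B q'" using eq eq' unfolding c by linarith
  then have "?A q = ?B q'" using s by simp
  moreover have "dist q p < d1" "dist q' p < d2"
    using q q' sm1 by (simp_all add: m_def dist_commute add.commute)
  then have "dist (?A q) (?A p) < e" "dist (?B q') (?B p) < e" using d by blast+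
  moreover have False if "a = b" "\<bar>a - c\<bar> < \<bar>c - d\<bar> / 2" "\<bar>b - d\<bar> < \<bar>c - d\<bar> / 2" for a b c d :: real
    using that by (auto simp: abs_if split: if_splits)
  ultimately show False unfolding e_def dist_real_def by blast
qed

lemma second_derivative_symmetric:
  fixes f :: "'a::euclidean_space \<Rightarrow> 'b::euclidean_space"
  assumes "open S" and sm: "smooth_on S f" and "p \<in> S"
  shows "frechet_derivative (\<lambda>x. frechet_derivative f (at x) u) (at p) v =
         frechet_derivative (\<lambda>x. frechet_derivative f (at x) v) (at p) u"
proof (rule euclidean_eqI)
  fix b :: 'b assume "b \<in> Basis"
  have smb: "smooth_on S (\<lambda>x. h x \<bullet> b)" if "smooth_on S h" for h :: "'a \<Rightarrow> 'b"
    by (rule smooth_on_linear_compose[OF assms(1) bounded_linear_inner_left that])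
  have D: "frechet_derivative (\<lambda>x. h x \<bullet> b) (at x) w = frechet_derivative h (at x) w \<bullet> b"
    if "smooth_on S h" "x \<in> S" for h :: "'a \<Rightarrow> 'b" and x w
    using fun_cong[OF frechet_derivative_at[OF bounded_linear.has_derivative[OF
        bounded_linear_inner_left smooth_on_has_derivative[OF that]]], symmetric] .
  have E: "frechet_derivative (\<lambda>x. frechet_derivative f (at x) w) (at p) w' \<bullet> b =
     frechet_derivative (\<lambda>x. frechet_derivative (\<lambda>x. f x \<bullet> b) (at x) w) (at p) w'" for w w'
  proof -
    have "frechet_derivative (\<lambda>x. frechet_derivative f (at x) w) (at p) w' \<bullet> b =
      frechet_derivative (\<lambda>x. frechet_derivative f (at x) w \<bullet> b) (at p) w'"
      by (rule D[OF smooth_on_frechet_derivative[OF sm] assms(3), symmetric])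
    also have "\<dots> = frechet_derivative (\<lambda>x. frechet_derivative (\<lambda>x. f x \<bullet> b) (at x) w) (at p) w'"
      by (rule fun_cong[OF frechet_derivative_cong_open[OF assms(1,3)]]) (simp add: D[OF sm])
    finally show ?thesis .
  qed
  show "frechet_derivative (\<lambda>x. frechet_derivative f (at x) u) (at p) v \<bullet> b =
        frechet_derivative (\<lambda>x. frechet_derivative f (at x) v) (at p) u \<bullet> b"
    by (rule trans[OF E trans[OF second_derivative_symmetric_real[OF assms(1) smb[OF sm] assms(3)] E[symmetric]]])
qed

section \<open>Smooth manifolds\<close>

text \<open>Charts are described by open images and open preimages instead of homeomorphisms of
  subspaces. In this form the property passes directly to \<open>prod_mfd\<close>, the domain of the
  multiplication map.\<close>

definition smooth_atlas :: "('a, 'e::euclidean_space) mfd \<Rightarrow> bool" where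
  "smooth_atlas M \<longleftrightarrow> topspace (mtop M) = (\<Union>(U, c)\<in>charts M. U) \<and>
     (\<forall>(U, c)\<in>charts M. openin (mtop M) U \<and> inj_on c U \<and>
        (\<forall>W. openin (mtop M) W \<longrightarrow> open (c ` (U \<inter> W))) \<and>
        (\<forall>T. open T \<longrightarrow> openin (mtop M) (U \<inter> c -` T)))"

text \<open>Extends \<open>smooth_fun_on\<close> to values in a Euclidean space, so that a chart is
  itself such a function on its domain.\<close>

definition smooth_vec_on ::
    "('a, 'e::euclidean_space) mfd \<Rightarrow> 'a set \<Rightarrow> ('a \<Rightarrow> 'b::euclidean_space) \<Rightarrow> bool" where
  "smooth_vec_on M W f \<longleftrightarrow>
     openin (mtop M) W \<and> (\<forall>(U, c)\<in>charts M. smooth_on (c ` (U \<inter> W)) (f \<circ> inv_into U c))"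

lemma smooth_fun_on_eq: "smooth_fun_on M W f \<longleftrightarrow> smooth_vec_on M W f"
  by (simp add: smooth_fun_on_def smooth_vec_on_def)

lemma smooth_atlas_chart:
  assumes "smooth_atlas M" "(U, c) \<in> charts M"
  shows "openin (mtop M) U" "inj_on c U" "openin (mtop M) W \<Longrightarrow> open (c ` (U \<inter> W))"
    "open T \<Longrightarrow> openin (mtop M) (U \<inter> c -` T)" "U \<subseteq> topspace (mtop M)" "open (c ` U)"
proof -
  show o: "openin (mtop M) U" and "inj_on c U" and
    *: "\<And>W. openin (mtop M) W \<Longrightarrow> open (c ` (U \<inter> W))"
    and "open T \<Longrightarrow> openin (mtop M) (U \<inter> c -` T)"
    using assms by (auto simp: smooth_atlas_def)
  then show "U \<subseteq> topspace (mtop M)" "open (c ` U)"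
    using openin_subset[OF o] *[OF o] by simp_all
qed

lemma smooth_atlas_cover:
  assumes "smooth_atlas M" "p \<in> topspace (mtop M)"
  obtains U c where "(U, c) \<in> charts M" "p \<in> U"
  using assms unfolding smooth_atlas_def by auto

lemma smooth_manifold_atlas:
  assumes "smooth_manifold M" shows "smooth_atlas M"
proof -
  have ch: "inj_on c U \<and> (\<forall>W. openin (mtop M) W \<longrightarrow> open (c ` (U \<inter> W))) \<and>
        (\<forall>T. open T \<longrightarrow> openin (mtop M) (U \<inter> c -` T))"
    if U: "openin (mtop M) U" and op: "open (c ` U)"
      and h: "homeomorphic_map (subtopology (mtop M) U) (top_of_set (c ` U)) c" for U and c :: "'a \<Rightarrow> 'b"
  proof (intro conjI allI impI)
    have ts: "topspace (subtopology (mtop M) U) = U" using openin_subset[OF U] by auto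
    show "inj_on c U" using homeomorphic_imp_injective_map[OF h] ts by simp
    show "open (c ` (U \<inter> W))" if "openin (mtop M) W" for W
    proof -
      have "openin (subtopology (mtop M) U) (U \<inter> W)"
        using that by (metis openin_subtopology_Int2)
      then have "openin (top_of_set (c ` U)) (c ` (U \<inter> W))"
        using homeomorphic_imp_open_map[OF h] unfolding open_map_def by blast
      then show ?thesis using op by (metis openin_open_trans)
    qed
    show "openin (mtop M) (U \<inter> c -` T)" if "open T" for T
    proof -
      have "openin (top_of_set (c ` U)) (c ` U \<inter> T)" using that by auto
      then have "openin (subtopology (mtop M) U) {x \<in> topspace (subtopology (mtop M) U). c x \<in> c ` U \<inter> T}"
        using homeomorphic_imp_continuous_map[OF h] by (metis openin_continuous_map_preimage)
      moreover have "{x \<in> topspace (subtopology (mtop M) U). c x \<in> c ` U \<inter> T} = U \<inter> c -` T"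
        using ts by auto
      ultimately show ?thesis using U by (metis openin_trans_full)
    qed
  qed
  show ?thesis
    unfolding smooth_atlas_def
  proof (intro conjI ballI, goal_cases)
    case 1
    then show ?case using assms by (simp add: smooth_manifold_def)
  next
    case (2 z)
    obtain U c where z: "z = (U, c)" by (cases z)
    then have "openin (mtop M) U" "open (c ` U)"
      "homeomorphic_map (subtopology (mtop M) U) (top_of_set (c ` U)) c"
      using assms 2 by (auto simp: smooth_manifold_def)
    then show ?case using ch z by simp
  qed
qed

lemma smooth_manifold_transition:
  assumes "smooth_manifold M" "(U, c) \<in> charts M" "(V, d) \<in> charts M"
  shows "smooth_on (c ` (U \<inter> V)) (d \<circ> inv_into U c)"
proof -
  have "\<forall>(U, c)\<in>charts M. \<forall>(V, d)\<in>charts M. smooth_on (c ` (U \<inter> V)) (d \<circ> inv_into U c)"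
    using assms(1) unfolding smooth_manifold_def by (elim conjE)
  then show ?thesis using assms(2,3) by blast
qed

lemma smooth_vec_on_chart_map:
  assumes "smooth_manifold M" "(U, c) \<in> charts M" shows "smooth_vec_on M U c"
  using smooth_atlas_chart(1)[OF smooth_manifold_atlas[OF assms(1)] assms(2)]
    smooth_manifold_transition[OF assms(1) _ assms(2)]
  by (auto simp: smooth_vec_on_def)

lemma smooth_vec_on_chart:
  assumes "smooth_vec_on M W f" "(U, c) \<in> charts M"
  shows "smooth_on (c ` (U \<inter> W)) (f \<circ> inv_into U c)"
  using assms unfolding smooth_vec_on_def by blast

lemma smooth_vec_on_linear:
  assumes "smooth_atlas M" "smooth_vec_on M W f" "bounded_linear L"
  shows "smooth_vec_on M W (\<lambda>x. L (f x))"
proof -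
  have W: "openin (mtop M) W" using assms(2) by (simp add: smooth_vec_on_def)
  have "smooth_on (c ` (U \<inter> W)) ((\<lambda>x. L (f x)) \<circ> inv_into U c)" if "(U, c) \<in> charts M" for U c
    using smooth_on_linear_compose[OF smooth_atlas_chart(3)[OF assms(1) that W] assms(3)
        smooth_vec_on_chart[OF assms(2) that]]
    by (simp add: comp_def)
  then show ?thesis using W by (auto simp: smooth_vec_on_def)
qed

lemma smooth_map_chart:
  assumes "smooth_map M N F" "(U, c) \<in> charts M" "(V, d) \<in> charts N"
  shows "smooth_on (c ` (U \<inter> F -` V)) (d \<circ> F \<circ> inv_into U c)"
  using assms unfolding smooth_map_def by blast

lemma smooth_map_continuous: "smooth_map M N F \<Longrightarrow> continuous_map (mtop M) (mtop N) F"
  by (simp add: smooth_map_def)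

lemma smooth_map_preimage:
  assumes "smooth_map M N F" "openin (mtop N) W"
  shows "openin (mtop M) (topspace (mtop M) \<inter> F -` W)"
proof -
  have "topspace (mtop M) \<inter> F -` W = {x \<in> topspace (mtop M). F x \<in> W}" by auto
  then show ?thesis
    using openin_continuous_map_preimage[OF smooth_map_continuous[OF assms(1)] assms(2)] by simp
qed

lemma smooth_map_in_topspace:
  "smooth_map M N F \<Longrightarrow> p \<in> topspace (mtop M) \<Longrightarrow> F p \<in> topspace (mtop N)"
  using continuous_map_image_subset_topspace[OF smooth_map_continuous] by blast

text \<open>In charts the composite is \<open>f \<circ> inv_into V d\<close> after
  \<open>d \<circ> F \<circ> inv_into U c\<close>, but \<open>d\<close> depends on the point, since
  \<open>F\<close> need not map \<open>U\<close> into one chart domain. Smoothness is therefore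
  shown on a neighbourhood of each point.\<close>

lemma smooth_vec_on_compose:
  assumes M: "smooth_atlas M" and N: "smooth_atlas N" and F: "smooth_map M N F"
    and f: "smooth_vec_on N W f"
  shows "smooth_vec_on M (topspace (mtop M) \<inter> F -` W) (\<lambda>x. f (F x))"
proof -
  have W: "openin (mtop N) W" using f by (simp add: smooth_vec_on_def)
  note open_pre = smooth_map_preimage[OF F]
  have "smooth_on (c ` (U \<inter> (topspace (mtop M) \<inter> F -` W))) ((\<lambda>x. f (F x)) \<circ> inv_into U c)"
    if Uc: "(U, c) \<in> charts M" for U c
  proof (rule smooth_on_locally)
    note inj = smooth_atlas_chart(2)[OF M Uc] and sub = smooth_atlas_chart(5)[OF M Uc]
    fix x assume "x \<in> c ` (U \<inter> (topspace (mtop M) \<inter> F -` W))"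
    then obtain p where p: "p \<in> U" "F p \<in> W" "x = c p" by auto
    then obtain V d where Vd: "(V, d) \<in> charts N" "F p \<in> V"
      using smooth_atlas_cover[OF N] openin_subset[OF W] by blast
    note injd = smooth_atlas_chart(2)[OF N Vd(1)]
    define T where "T = c ` (U \<inter> (topspace (mtop M) \<inter> F -` (V \<inter> W)))"
    have T: "open T" unfolding T_def
      by (intro smooth_atlas_chart(3)[OF M Uc] open_pre openin_Int W smooth_atlas_chart(1)[OF N Vd(1)])
    have "smooth_on T (d \<circ> F \<circ> inv_into U c)"
      by (rule smooth_on_subset[OF smooth_map_chart[OF F Uc Vd(1)]]) (auto simp: T_def)
    moreover have "(d \<circ> F \<circ> inv_into U c) ` T \<subseteq> d ` (V \<inter> W)" using inj by (auto simp: T_def)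
    ultimately have "smooth_on T (\<lambda>y. (f \<circ> inv_into V d) ((d \<circ> F \<circ> inv_into U c) y))"
      using smooth_on_compose[OF T smooth_atlas_chart(3)[OF N Vd(1) W] _ smooth_vec_on_chart[OF f Vd(1)]]
      by blast
    then have "smooth_on T ((\<lambda>x. f (F x)) \<circ> inv_into U c)"
      by (rule smooth_on_cong[OF T, rotated]) (use inj injd in \<open>auto simp: T_def\<close>)
    moreover have "x \<in> T" using p Vd(2) sub by (auto simp: T_def)
    ultimately show "\<exists>T. open T \<and> x \<in> T \<and> smooth_on T ((\<lambda>x. f (F x)) \<circ> inv_into U c)"
      using T by blast
  qed
  then show ?thesis using open_pre[OF W] by (auto simp: smooth_vec_on_def)
qed

lemma smooth_map_vec_on:
  assumes "smooth_atlas M" "smooth_atlas N" "smooth_map M N F" "(V, d) \<in> charts N"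
  shows "smooth_vec_on M (topspace (mtop M) \<inter> F -` V) (\<lambda>x. d (F x))"
proof -
  have "smooth_on (c ` (U \<inter> (topspace (mtop M) \<inter> F -` V))) ((\<lambda>x. d (F x)) \<circ> inv_into U c)"
    if Uc: "(U, c) \<in> charts M" for U c
    using smooth_on_subset[OF smooth_map_chart[OF assms(3) Uc assms(4)],
        of "c ` (U \<inter> (topspace (mtop M) \<inter> F -` V))"]
    by (auto simp: comp_def)
  then show ?thesis
    using smooth_map_preimage[OF assms(3) smooth_atlas_chart(1)[OF assms(2,4)]]
    by (auto simp: smooth_vec_on_def)
qed

lemma smooth_map_compose:
  assumes M: "smooth_atlas M" and N: "smooth_atlas N" and P: "smooth_atlas P"
    and F: "smooth_map M N F" and K: "smooth_map N P K"
  shows "smooth_map M P (\<lambda>x. K (F x))"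
  unfolding smooth_map_def
proof (intro conjI ballI, goal_cases)
  case 1
  then show ?case
    using continuous_map_compose[OF smooth_map_continuous[OF F] smooth_map_continuous[OF K]]
    by (simp add: comp_def)
next
  case (2 z)
  obtain U c where z: "z = (U, c)" by (cases z)
  have "smooth_on (c ` (U \<inter> (\<lambda>x. K (F x)) -` V)) (d \<circ> (\<lambda>x. K (F x)) \<circ> inv_into U c)"
    if Vd: "(V, d) \<in> charts P" for V d
  proof -
    have "U \<inter> (\<lambda>x. K (F x)) -` V = U \<inter> (topspace (mtop M) \<inter> F -` (topspace (mtop N) \<inter> K -` V))"
      using smooth_atlas_chart(5)[OF M] smooth_map_in_topspace[OF F] 2 z by blast
    then show ?thesis
      using smooth_vec_on_chart[OF smooth_vec_on_compose[OF M N F smooth_map_vec_on[OF N P K Vd]]] 2 z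
      by (simp add: comp_def)
  qed
  then show ?case using z by auto
qed

lemma smooth_map_const:
  assumes "smooth_atlas M" "q \<in> topspace (mtop N)" shows "smooth_map M N (\<lambda>x. q)"
  unfolding smooth_map_def
proof (intro conjI ballI, goal_cases)
  case 1
  then show ?case using assms(2) by simp
next
  case (2 z)
  obtain U c where z: "z = (U, c)" by (cases z)
  have "smooth_on (c ` (U \<inter> (\<lambda>x. q) -` V)) (d \<circ> (\<lambda>x. q) \<circ> inv_into U c)" for V and d :: "'c \<Rightarrow> 'd"
  proof -
    have "open (c ` (U \<inter> (\<lambda>x. q) -` V))"
      using smooth_atlas_chart(6)[OF assms(1)] 2 z by (cases "q \<in> V") auto
    from smooth_on_const[OF this, of "d q"] show ?thesis by (simp only: comp_def)
  qed
  then show ?case using z by auto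
qed

lemma smooth_map_id:
  assumes "smooth_manifold M" shows "smooth_map M M (\<lambda>x. x)"
  using smooth_manifold_transition[OF assms]
  by (auto simp: smooth_map_def comp_def)

section \<open>Product manifolds\<close>

lemma prod_mfd_sel [simp]:
  "mtop (prod_mfd M N) = prod_topology (mtop M) (mtop N)"
  "charts (prod_mfd M N) = (\<lambda>((U, c), (V, d)). (U \<times> V, map_prod c d)) ` (charts M \<times> charts N)"
  by (simp_all add: prod_mfd_def)

lemma smooth_atlas_prod:
  assumes M: "smooth_atlas M" and N: "smooth_atlas N" shows "smooth_atlas (prod_mfd M N)"
proof -
  have "inj_on (map_prod c d) (U \<times> V)" (is ?inj)
    and "openin (prod_topology (mtop M) (mtop N)) (U \<times> V)" (is ?op)
    and "\<forall>W. openin (prod_topology (mtop M) (mtop N)) W \<longrightarrow> open (map_prod c d ` (U \<times> V \<inter> W))" (is "\<forall>W. ?A W")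
    and "\<forall>T. open T \<longrightarrow> openin (prod_topology (mtop M) (mtop N)) (U \<times> V \<inter> map_prod c d -` T)" (is "\<forall>T. ?B T")
    if U: "(U, c) \<in> charts M" and V: "(V, d) \<in> charts N" for U c V d
  proof -
    note cU = smooth_atlas_chart[OF M U] and cV = smooth_atlas_chart[OF N V]
    show ?inj using cU(2) cV(2) by (intro map_prod_inj_on)
    show ?op using cU(1) cV(1) by (simp add: openin_prod_Times_iff)
    have "?A W" for W
    proof (rule impI, subst open_subopen, rule ballI)
      fix z assume W: "openin (prod_topology (mtop M) (mtop N)) W" and "z \<in> map_prod c d ` (U \<times> V \<inter> W)"
      then obtain x y where xy: "x \<in> U" "y \<in> V" "(x, y) \<in> W" "z = (c x, d y)" by auto
      then obtain A B where AB: "openin (mtop M) A" "openin (mtop N) B" "x \<in> A" "y \<in> B" "A \<times> B \<subseteq> W"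
        using W unfolding openin_prod_topology_alt by metis
      have "open (c ` (U \<inter> A) \<times> d ` (V \<inter> B))" using cU(3)[OF AB(1)] cV(3)[OF AB(2)] by (rule open_Times)
      moreover have "z \<in> c ` (U \<inter> A) \<times> d ` (V \<inter> B)" using xy AB by auto
      moreover have "c ` (U \<inter> A) \<times> d ` (V \<inter> B) \<subseteq> map_prod c d ` (U \<times> V \<inter> W)"
      proof
        fix w assume "w \<in> c ` (U \<inter> A) \<times> d ` (V \<inter> B)"
        then obtain a b where "a \<in> U \<inter> A" "b \<in> V \<inter> B" "w = map_prod c d (a, b)" by auto
        then show "w \<in> map_prod c d ` (U \<times> V \<inter> W)" using AB(5) by blast
      qed
      ultimately show "\<exists>T. open T \<and> z \<in> T \<and> T \<subseteq> map_prod c d ` (U \<times> V \<inter> W)" by blast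
    qed
    then show "\<forall>W. ?A W" ..
    have "?B T" for T
    proof
      assume T: "open T"
      have "\<exists>U' V'. openin (mtop M) U' \<and> openin (mtop N) V' \<and> x \<in> U' \<and> y \<in> V' \<and>
          U' \<times> V' \<subseteq> U \<times> V \<inter> map_prod c d -` T"
        if "(x, y) \<in> U \<times> V \<inter> map_prod c d -` T" for x y
      proof -
        have xy: "x \<in> U" "y \<in> V" "(c x, d y) \<in> T" using that by auto
        obtain A B where AB: "open A" "open B" "(c x, d y) \<in> A \<times> B" "A \<times> B \<subseteq> T"
          using open_prod_elim[OF T xy(3)] by metis
        show ?thesis
          using cU(4)[OF AB(1)] cV(4)[OF AB(2)] xy AB(3,4)
          by (intro exI[of _ "U \<inter> c -` A"] exI[of _ "V \<inter> d -` B"]) auto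
      qed
      then show "openin (prod_topology (mtop M) (mtop N)) (U \<times> V \<inter> map_prod c d -` T)"
        unfolding openin_prod_topology_alt by blast
    qed
    then show "\<forall>T. ?B T" ..
  qed
  note ch = this
  show ?thesis
    unfolding smooth_atlas_def
  proof (intro conjI ballI, goal_cases)
    case 1
    have "topspace (mtop M) = (\<Union>w\<in>charts M. fst w)" "topspace (mtop N) = (\<Union>w\<in>charts N. fst w)"
      using M N by (simp_all add: smooth_atlas_def case_prod_unfold)
    then have "topspace (mtop (prod_mfd M N)) = (\<Union>w\<in>charts M. fst w) \<times> (\<Union>w\<in>charts N. fst w)"
      by simp
    also have "\<dots> = (\<Union>w\<in>charts M \<times> charts N. fst (fst w) \<times> fst (snd w))"
      by auto
    also have "\<dots> = (\<Union>(U, c)\<in>charts (prod_mfd M N). U)"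
      by (simp add: case_prod_unfold)
    finally show ?case .
  next
    case (2 z)
    then obtain U c V d where z: "z = (U \<times> V, map_prod c d)" "(U, c) \<in> charts M" "(V, d) \<in> charts N"
      by auto
    show ?case unfolding z(1) case_prod_conv prod_mfd_sel(1) using ch[OF z(2,3)] by (intro conjI)
  qed
qed

lemma smooth_map_Pair:
  assumes M: "smooth_atlas M" and N: "smooth_atlas N" and P: "smooth_atlas P"
    and F: "smooth_map M N F" and K: "smooth_map M P K"
  shows "smooth_map M (prod_mfd N P) (\<lambda>x. (F x, K x))"
  unfolding smooth_map_def
proof (intro conjI ballI, goal_cases)
  case 1
  then show ?case
    using smooth_map_continuous[OF F] smooth_map_continuous[OF K] by (simp add: continuous_map_paired)
next
  case (2 z)
  obtain U c where z: "z = (U, c)" by (cases z)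
  have Uc: "(U, c) \<in> charts M" using 2 z by simp
  have "smooth_on (c ` (U \<inter> (\<lambda>x. (F x, K x)) -` (V \<times> V')))
      (map_prod d d' \<circ> (\<lambda>x. (F x, K x)) \<circ> inv_into U c)"
    if y: "(V, d) \<in> charts N" "(V', d') \<in> charts P" for V d V' d'
  proof -
    let ?S = "c ` (U \<inter> (\<lambda>x. (F x, K x)) -` (V \<times> V'))"
    have eq: "U \<inter> (\<lambda>x. (F x, K x)) -` (V \<times> V') =
        U \<inter> ((topspace (mtop M) \<inter> F -` V) \<inter> (topspace (mtop M) \<inter> K -` V'))"
      using smooth_atlas_chart(5)[OF M Uc] by auto
    have S: "open ?S" unfolding eq
      by (intro smooth_atlas_chart(3)[OF M Uc] openin_Int smooth_map_preimage[OF F] smooth_map_preimage[OF K]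
          smooth_atlas_chart(1)[OF N y(1)] smooth_atlas_chart(1)[OF P y(2)])
    have "smooth_on ?S (\<lambda>x. ((d \<circ> F \<circ> inv_into U c) x, (d' \<circ> K \<circ> inv_into U c) x))"
      by (rule smooth_on_Pair[OF S smooth_on_subset[OF smooth_map_chart[OF F Uc y(1)]]
            smooth_on_subset[OF smooth_map_chart[OF K Uc y(2)]]]) auto
    then show ?thesis by (simp add: comp_def)
  qed
  then show ?case using z by auto
qed

section \<open>Smooth curves\<close>

lemma interval_mfd_sel [simp]:
  "mtop (interval_mfd I) = top_of_set I" "charts (interval_mfd I) = {(I, id)}"
  by (simp_all add: interval_mfd_def)

lemma smooth_atlas_interval:
  assumes "open I" shows "smooth_atlas (interval_mfd I)"
  using assms by (auto simp: smooth_atlas_def openin_open_eq)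

lemma smooth_vec_on_interval:
  assumes "open I" shows "smooth_vec_on (interval_mfd I) W f \<longleftrightarrow> open W \<and> W \<subseteq> I \<and> smooth_on W f"
proof -
  have "smooth_on (I \<inter> W) (f \<circ> inv_into I id) \<longleftrightarrow> smooth_on W f" if "open W" "W \<subseteq> I"
  proof -
    have "I \<inter> W = W" using that by auto
    moreover have "(f \<circ> inv_into I id) x = f x" if "x \<in> W" for x
      using \<open>W \<subseteq> I\<close> that inv_into_f_f[of id I x] by auto
    ultimately show ?thesis using smooth_on_cong[OF \<open>open W\<close>] by metis
  qed
  then show ?thesis using assms by (auto simp: smooth_vec_on_def openin_open_eq)
qed

lemma smooth_curve_compose:
  assumes "smooth_atlas M" "open I" "smooth_map (interval_mfd I) M \<gamma>" "smooth_vec_on M W f"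
  shows "open (I \<inter> \<gamma> -` W)" "smooth_on (I \<inter> \<gamma> -` W) (\<lambda>t. f (\<gamma> t))"
  using smooth_vec_on_compose[OF smooth_atlas_interval[OF assms(2)] assms(1,3,4)]
  by (simp_all add: smooth_vec_on_interval[OF assms(2)])

text \<open>Straight segments in a chart are the curves that realise prescribed tangent vectors, in
  the group as well as in an immersed subgroup.\<close>

lemma smooth_map_chart_curve:
  assumes M: "smooth_manifold M" and Uc: "(U, c) \<in> charts M" and I: "open I"
    and S: "\<And>s. s \<in> I \<Longrightarrow> x + s *\<^sub>R z \<in> c ` U"
  shows "smooth_map (interval_mfd I) M (\<lambda>s. inv_into U c (x + s *\<^sub>R z))"
proof -
  note A = smooth_manifold_atlas[OF M]
  note cU = smooth_atlas_chart[OF A Uc]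
  let ?k = "\<lambda>s. inv_into U c (x + s *\<^sub>R z)"
  \<comment> \<open>Preimages under the curve are preimages of open sets under an affine map. This
    yields both the continuity and the openness of the domains on which smoothness is
    tested.\<close>
  have pre: "I \<inter> ?k -` W = I \<inter> (\<lambda>s. x + s *\<^sub>R z) -` (c ` (U \<inter> W))" for W
  proof (rule equalityI; rule subsetI)
    fix s assume "s \<in> I \<inter> ?k -` W"
    then have "s \<in> I" "?k s \<in> U \<inter> W" "c (?k s) = x + s *\<^sub>R z"
      using S by (auto intro: inv_into_into f_inv_into_f)
    then show "s \<in> I \<inter> (\<lambda>s. x + s *\<^sub>R z) -` (c ` (U \<inter> W))"
      by (metis IntI image_eqI vimageI)
  next
    fix s assume s: "s \<in> I \<inter> (\<lambda>s. x + s *\<^sub>R z) -` (c ` (U \<inter> W))"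
    then obtain q where "q \<in> U" "q \<in> W" "x + s *\<^sub>R z = c q" by auto
    then show "s \<in> I \<inter> ?k -` W" using s cU(2) by simp
  qed
  have aff: "open ((\<lambda>s. x + s *\<^sub>R z) -` T)" if "open T" for T
    by (rule open_vimage[OF that]) (intro continuous_intros)
  have op: "open (I \<inter> ?k -` W)" if "openin (mtop M) W" for W
    unfolding pre using I aff[OF cU(3)[OF that]] by auto
  show ?thesis
    unfolding smooth_map_def
  proof (intro conjI ballI, goal_cases)
    case 1
    have "{s \<in> I. ?k s \<in> W} = I \<inter> ?k -` W" for W by auto
    then show ?case
      using op S cU(5) I inv_into_into[of _ c U]
      by (simp add: continuous_map_def Pi_iff openin_open_eq subset_iff)
  next
    case (2 w)
    have "smooth_on (id ` (I \<inter> ?k -` V)) (d \<circ> ?k \<circ> inv_into I id)" if Vd: "(V, d) \<in> charts M" for V d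
    proof -
      have op': "open (I \<inter> ?k -` V)" by (rule op[OF smooth_atlas_chart(1)[OF A Vd]])
      have aff: "smooth_on (I \<inter> ?k -` V) (\<lambda>s. x + s *\<^sub>R z)"
        by (rule smooth_on_add[OF op' smooth_on_const[OF op']
              smooth_on_bounded_linear[OF op' bounded_linear_scaleR_left]])
      have "smooth_on (I \<inter> ?k -` V) (\<lambda>s. (d \<circ> inv_into U c) (x + s *\<^sub>R z))"
        by (rule smooth_on_compose[OF op' cU(3)[OF smooth_atlas_chart(1)[OF A Vd]] aff
              smooth_manifold_transition[OF M Uc Vd]]) (unfold pre, auto)
      then have "smooth_on (I \<inter> ?k -` V) (d \<circ> ?k \<circ> inv_into I id)"
        by (rule smooth_on_cong[OF op', rotated]) (use inv_into_f_f[of id I] in auto)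
      then show ?thesis by simp
    qed
    then show ?case using 2 by auto
  qed
qed

text \<open>Every set of the form \<open>f r\<close> satisfies \<open>P\<close> is open, so the
  level set of \<open>f p\<close> and its complement are both open.\<close>

lemma connected_space_locally_constant:
  assumes "connected_space X"
    and "\<And>p. p \<in> topspace X \<Longrightarrow> \<exists>W. openin X W \<and> p \<in> W \<and> (\<forall>q\<in>W. f q = f p)"
    and "p \<in> topspace X" "q \<in> topspace X"
  shows "f p = f q"
proof -
  have op: "openin X {r \<in> topspace X. P (f r)}" for P
  proof (subst openin_subopen, rule ballI)
    fix r assume r: "r \<in> {r \<in> topspace X. P (f r)}"
    then have "r \<in> topspace X" by simp
    from assms(2)[OF this] obtain W where W: "openin X W" "r \<in> W" "\<forall>q\<in>W. f q = f r" by blast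
    have "W \<subseteq> {r \<in> topspace X. P (f r)}"
    proof
      fix q assume q: "q \<in> W"
      then have "f q = f r" "q \<in> topspace X" using W(3) openin_subset[OF W(1)] by blast+
      then show "q \<in> {r \<in> topspace X. P (f r)}" using r by simp
    qed
    then show "\<exists>T. openin X T \<and> r \<in> T \<and> T \<subseteq> {r \<in> topspace X. P (f r)}" using W by blast
  qed
  let ?A = "{r \<in> topspace X. f r = f p}"
  have "topspace X - ?A = {r \<in> topspace X. f r \<noteq> f p}" by auto
  then have "closedin X ?A" using op[of "\<lambda>y. y \<noteq> f p"] by (simp add: closedin_def)
  with op[of "\<lambda>y. y = f p"] assms(1) have "?A = {} \<or> ?A = topspace X"
    unfolding connected_space_clopen_in by blast
  then have "q \<in> ?A" using assms(3,4) by blast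
  then show ?thesis by simp
qed

section \<open>Left-invariant vector fields in a chart\<close>

lemma frechet_derivative_partial:
  assumes "smooth_on P h" "(x, y) \<in> P"
  shows "((\<lambda>t. h (x, t)) has_derivative (\<lambda>v. frechet_derivative h (at (x, y)) (0, v))) (at y)"
    and "((\<lambda>t. h (t, y)) has_derivative (\<lambda>v. frechet_derivative h (at (x, y)) (v, 0))) (at x)"
proof -
  note h = smooth_on_has_derivative[OF assms]
  have "((\<lambda>t. (x, t)) has_derivative (\<lambda>v. (0, v))) (at y)"
    by (intro has_derivative_Pair has_derivative_const has_derivative_ident)
  from has_derivative_compose[OF this h]
  show "((\<lambda>t. h (x, t)) has_derivative (\<lambda>v. frechet_derivative h (at (x, y)) (0, v))) (at y)" .
  have "((\<lambda>t. (t, y)) has_derivative (\<lambda>v. (v, 0))) (at x)"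
    by (intro has_derivative_Pair has_derivative_const has_derivative_ident)
  from has_derivative_compose[OF this h]
  show "((\<lambda>t. h (t, y)) has_derivative (\<lambda>v. frechet_derivative h (at (x, y)) (v, 0))) (at x)" .
qed

lemma inv_into_map_prod:
  assumes "inj_on d V" "inj_on e V'" "p \<in> map_prod d e ` (V \<times> V')"
  shows "inv_into (V \<times> V') (map_prod d e) p = (inv_into V d (fst p), inv_into V' e (snd p))"
proof -
  obtain x y where "x \<in> V" "y \<in> V'" "p = map_prod d e (x, y)" using assms(3) by auto
  then show ?thesis
    using assms(1,2) inv_into_f_f[OF map_prod_inj_on[OF assms(1,2)], of "(x, y)"] by simp
qed

lemma lie_group_smooth:
  assumes "lie_group G M"
  shows lie_group_group: "group G" and lie_group_manifold: "smooth_manifold M"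
    and lie_group_atlas: "smooth_atlas M" and lie_group_topspace: "topspace (mtop M) = carrier G"
    and lie_group_mult: "smooth_map (prod_mfd M M) M (\<lambda>(x, y). x \<otimes>\<^bsub>G\<^esub> y)"
    and lie_group_inv: "smooth_map M M (\<lambda>x. inv\<^bsub>G\<^esub> x)"
  using assms smooth_manifold_atlas by (auto simp: lie_group_def)

lemma lie_group_left_mult:
  assumes "lie_group G M" "g \<in> carrier G" shows "smooth_map M M (\<lambda>x. g \<otimes>\<^bsub>G\<^esub> x)"
proof -
  note l = lie_group_smooth[OF assms(1)]
  have "smooth_map M (prod_mfd M M) (\<lambda>x. (g, x))"
    by (intro smooth_map_Pair l smooth_map_const smooth_map_id) (simp add: l assms(2))
  from smooth_map_compose[OF l(3) smooth_atlas_prod[OF l(3) l(3)] l(3) this l(5)]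
  show ?thesis by simp
qed

lemma lie_group_right_mult:
  assumes "lie_group G M" "g \<in> carrier G" shows "smooth_map M M (\<lambda>x. x \<otimes>\<^bsub>G\<^esub> g)"
proof -
  note l = lie_group_smooth[OF assms(1)]
  have "smooth_map M (prod_mfd M M) (\<lambda>x. (x, g))"
    by (intro smooth_map_Pair l smooth_map_const smooth_map_id) (simp add: l assms(2))
  from smooth_map_compose[OF l(3) smooth_atlas_prod[OF l(3) l(3)] l(3) this l(5)]
  show ?thesis by simp
qed

text \<open>The tangent space at the identity is identified with the model space \<open>'e\<close> through one fixed
  chart \<open>(U, c)\<close> at the identity.\<close>

locale lie_group_chart =
  fixes G :: "('g, 'm) monoid_scheme" (structure)
    and M :: "('g, 'e::euclidean_space) mfd"
    and U :: "'g set" and c :: "'g \<Rightarrow> 'e"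
  assumes lie_group: "lie_group G M" and chart: "(U, c) \<in> charts M" and one_in: "\<one> \<in> U"
begin

sublocale group G by (rule lie_group_group[OF lie_group])

lemmas manifold = lie_group_manifold[OF lie_group]
lemmas atlas = lie_group_atlas[OF lie_group]
lemmas topspace_eq = lie_group_topspace[OF lie_group]
lemmas mult_smooth = lie_group_mult[OF lie_group]
lemmas inv_smooth = lie_group_inv[OF lie_group]
lemmas chart_props = smooth_atlas_chart[OF atlas chart]
lemmas left_smooth = lie_group_left_mult[OF lie_group]
lemmas right_smooth = lie_group_right_mult[OF lie_group]

abbreviation "x0 \<equiv> c \<one>"
abbreviation "ci \<equiv> inv_into U c"

lemma U_carrier: "p \<in> U \<Longrightarrow> p \<in> carrier G"
  using chart_props(5) topspace_eq by auto

lemma ci_c [simp]: "p \<in> U \<Longrightarrow> ci (c p) = p"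
  using chart_props(2) by simp

lemma c_ci [simp]: "x \<in> c ` U \<Longrightarrow> c (ci x) = x"
  by (rule f_inv_into_f)

lemma ci_U: "x \<in> c ` U \<Longrightarrow> ci x \<in> U"
  by (rule inv_into_into)

lemma ci_carrier [simp]: "x \<in> c ` U \<Longrightarrow> ci x \<in> carrier G"
  using ci_U U_carrier by blast

lemma x0_in [simp]: "x0 \<in> c ` U" using one_in by simp

lemma open_cU: "open (c ` U)" by (rule chart_props(6))

lemma smooth_c: "smooth_vec_on M U c"
  by (rule smooth_vec_on_chart_map[OF manifold chart])

lemma smooth_c_inner: "smooth_fun_on M U (\<lambda>p. c p \<bullet> b)"
  unfolding smooth_fun_on_eq
  by (rule smooth_vec_on_linear[OF atlas smooth_c bounded_linear_inner_left])

section \<open>Tangent vectors at the identity\<close>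

lemma smooth_near_compose:
  assumes "smooth_map M M F" "p \<in> carrier G" "smooth_near M (F p) f"
  shows "smooth_near M p (\<lambda>x. f (F x))"
proof -
  obtain W where W: "F p \<in> W" "smooth_vec_on M W f"
    using assms(3) by (auto simp: smooth_near_def smooth_fun_on_eq)
  have "p \<in> topspace (mtop M) \<inter> F -` W" using W(1) assms(2) topspace_eq by simp
  with smooth_vec_on_compose[OF atlas atlas assms(1) W(2)] show ?thesis
    unfolding smooth_near_def smooth_fun_on_eq by (intro exI conjI)
qed

lemma smooth_near_has_derivative:
  assumes "smooth_near M \<one> f"
  shows "((\<lambda>x. f (ci x)) has_derivative frechet_derivative (\<lambda>x. f (ci x)) (at x0)) (at x0)"
proof -
  obtain W where "\<one> \<in> W" "smooth_vec_on M W f"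
    using assms by (auto simp: smooth_near_def smooth_fun_on_eq)
  then show ?thesis
    using smooth_on_has_derivative[OF smooth_vec_on_chart[OF _ chart], of W f x0] one_in
    by (auto simp: comp_def)
qed

text \<open>The default 0 agrees with that of \<open>velocity\<close> and
  \<open>pushforward\<close>, so comparisons with them are equalities of functionals.\<close>

definition tvec :: "'e \<Rightarrow> ('g \<Rightarrow> real) \<Rightarrow> real" where
  "tvec z = (\<lambda>f. if smooth_near M \<one> f then frechet_derivative (\<lambda>x. f (ci x)) (at x0) z else 0)"

lemma curve_differentiable:
  assumes "open I" "smooth_map (interval_mfd I) M k" "t \<in> I" "k t \<in> U"
  shows "((\<lambda>s. c (k s)) has_vector_derivative vector_derivative (\<lambda>s. c (k s)) (at t)) (at t)"
proof -
  have "(\<lambda>s. c (k s)) differentiable (at t)"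
    by (rule smooth_on_differentiable[OF smooth_curve_compose(2)[OF atlas assms(1,2) smooth_c]])
       (use assms in auto)
  then show ?thesis by (simp add: vector_derivative_works)
qed

text \<open>The chain rule through the chart. It asks only for a derivative of \<open>f\<close> at
  the identity, because besides test functions it is applied to the vector-valued function that
  sends \<open>g\<close> to \<open>Ad g w\<close>.\<close>

lemma curve_has_derivative:
  assumes I: "open I" "t \<in> I" and k: "continuous_map (top_of_set I) (mtop M) k" "k t = \<one>"
    and z: "((\<lambda>s. c (k s)) has_vector_derivative z) (at t)"
    and f: "((\<lambda>x. f (ci x)) has_derivative f') (at x0)"
  shows "((\<lambda>s. f (k s)) has_vector_derivative f' z) (at t)"
proof -
  have "openin (top_of_set I) {s \<in> topspace (top_of_set I). k s \<in> U}"
    using k(1) chart_props(1) by (rule openin_continuous_map_preimage)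
  then have op: "open {s \<in> I. k s \<in> U}" using I(1) by (simp add: openin_open_eq)
  have "((\<lambda>s. f (ci (c (k s)))) has_derivative (\<lambda>h. f' (h *\<^sub>R z))) (at t)"
    using has_derivative_compose[of "\<lambda>s. c (k s)" "\<lambda>h. h *\<^sub>R z" t UNIV "\<lambda>x. f (ci x)" f'] z f k(2)
    by (simp add: has_vector_derivative_def)
  moreover have "(\<lambda>h. f' (h *\<^sub>R z)) = (\<lambda>h. h *\<^sub>R f' z)"
    using linear_cmul[OF has_derivative_linear[OF f]] by auto
  ultimately have "((\<lambda>s. f (ci (c (k s)))) has_derivative (\<lambda>h. h *\<^sub>R f' z)) (at t)" by simp
  then show ?thesis unfolding has_vector_derivative_def
    by (rule has_derivative_transform_within_open[OF _ op]) (use I k one_in in auto)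
qed

lemma velocity_eq_tvec:
  assumes "open I" "t \<in> I" "smooth_map (interval_mfd I) M k" "k t = \<one>"
    and "((\<lambda>s. c (k s)) has_vector_derivative z) (at t)"
  shows "velocity M k t = tvec z"
proof
  fix f
  show "velocity M k t f = tvec z f"
  proof (cases "smooth_near M \<one> f")
    case True
    have "((\<lambda>s. f (k s)) has_real_derivative frechet_derivative (\<lambda>x. f (ci x)) (at x0) z) (at t)"
      using curve_has_derivative[OF assms(1,2) _ assms(4,5) smooth_near_has_derivative[OF True]]
        smooth_map_continuous[OF assms(3)]
      by (simp add: has_real_derivative_iff_has_vector_derivative)
    then show ?thesis using True assms(4) by (simp add: velocity_def tvec_def DERIV_imp_deriv)
  qed (simp add: velocity_def tvec_def assms(4))
qed

lemma curve_with_velocity: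
  obtains k \<epsilon> where "\<epsilon> > 0" "smooth_map (interval_mfd {-\<epsilon><..<\<epsilon>}) M k" "k 0 = \<one>"
    "((\<lambda>s. c (k s)) has_vector_derivative z) (at 0)"
proof -
  have "open ((\<lambda>s::real. x0 + s *\<^sub>R z) -` (c ` U))"
    by (rule open_vimage[OF open_cU]) (intro continuous_intros)
  moreover have "0 \<in> (\<lambda>s::real. x0 + s *\<^sub>R z) -` (c ` U)" by simp
  ultimately obtain \<epsilon> where e: "\<epsilon> > 0" "ball 0 \<epsilon> \<subseteq> (\<lambda>s::real. x0 + s *\<^sub>R z) -` (c ` U)"
    using open_contains_ball by blast
  have b: "ball 0 \<epsilon> = {-\<epsilon><..<\<epsilon>}" by (auto simp: dist_real_def)
  let ?k = "\<lambda>s. ci (x0 + s *\<^sub>R z)"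
  have "smooth_map (interval_mfd {-\<epsilon><..<\<epsilon>}) M ?k"
    by (rule smooth_map_chart_curve[OF manifold chart]) (use e b in auto)
  moreover have "((\<lambda>s. x0 + s *\<^sub>R z) has_vector_derivative z) (at 0)"
    by (auto intro!: derivative_eq_intros simp: has_vector_derivative_def)
  then have "((\<lambda>s. c (?k s)) has_vector_derivative z) (at 0)"
    by (rule has_vector_derivative_transform_within_open[of _ _ _ "{-\<epsilon><..<\<epsilon>}"]) (use e b in auto)
  ultimately show ?thesis using that[OF e(1)] one_in by simp
qed

lemma tangent_space_one: "tangent_space M \<one> = range tvec"
proof (intro equalityI subsetI)
  fix v assume "v \<in> tangent_space M \<one>"
  then obtain k \<epsilon> where k: "\<epsilon> > 0" "smooth_map (interval_mfd {-\<epsilon><..<\<epsilon>}) M k" "k 0 = \<one>" "v = velocity M k 0"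
    by (auto simp: tangent_space_def)
  have "velocity M k 0 = tvec (vector_derivative (\<lambda>s. c (k s)) (at 0))"
    by (rule velocity_eq_tvec[OF _ _ k(2,3) curve_differentiable[OF _ k(2)]]) (use k one_in in auto)
  then show "v \<in> range tvec" using k by simp
next
  fix v assume "v \<in> range tvec"
  then obtain z where z: "v = tvec z" by auto
  obtain k \<epsilon> where k: "\<epsilon> > 0" "smooth_map (interval_mfd {-\<epsilon><..<\<epsilon>}) M k" "k 0 = \<one>"
    "((\<lambda>s. c (k s)) has_vector_derivative z) (at 0)" using curve_with_velocity .
  have "velocity M k 0 = tvec z" by (rule velocity_eq_tvec[OF _ _ k(2,3,4)]) (use k in auto)
  then show "v \<in> tangent_space M \<one>"
    unfolding tangent_space_def mem_Collect_eq z using k(1-3) by metis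
qed

text \<open>Chart coordinates are admissible test functions and recover \<open>z\<close>. The
  passage from functionals back to vectors of the model space rests on them.\<close>

lemma tvec_inner: "tvec z (\<lambda>p. c p \<bullet> b) = z \<bullet> b"
proof -
  have "frechet_derivative (\<lambda>x. c (ci x) \<bullet> b) (at x0) = frechet_derivative (\<lambda>x. x \<bullet> b) (at x0)"
    by (rule frechet_derivative_cong_open[OF open_cU]) auto
  also have "\<dots> = (\<lambda>x. x \<bullet> b)"
    by (rule frechet_derivative_at[symmetric]) (rule bounded_linear_imp_has_derivative[OF bounded_linear_inner_left])
  finally show ?thesis
    using smooth_c_inner one_in by (auto simp: tvec_def smooth_near_def)
qed

lemma tvec_inject: "tvec z = tvec w \<longleftrightarrow> z = w"
  by (metis euclidean_eqI tvec_inner)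

text \<open>The left-invariant field with value \<open>tvec z\<close> at the identity. The
  restriction to \<open>carrier G\<close> makes it extensional, as
  \<open>smooth_vector_field\<close> demands.\<close>

definition left_field :: "'e \<Rightarrow> 'g \<Rightarrow> ('g \<Rightarrow> real) \<Rightarrow> real" where
  "left_field z = (\<lambda>g\<in>carrier G. \<lambda>f.
     if smooth_near M g f then frechet_derivative (\<lambda>x. f (g \<otimes> ci x)) (at x0) z else 0)"

lemma left_field_one: "left_field z \<one> = tvec z"
proof
  fix f :: "'g \<Rightarrow> real"
  have "frechet_derivative (\<lambda>x. f (\<one> \<otimes> ci x)) (at x0) = frechet_derivative (\<lambda>x. f (ci x)) (at x0)"
    by (rule frechet_derivative_cong_open[OF open_cU]) auto
  then show "left_field z \<one> f = tvec z f" by (simp add: left_field_def tvec_def)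
qed

lemma left_field_eq_pushforward:
  assumes "g \<in> carrier G"
  shows "left_field z g = pushforward M (\<lambda>x. g \<otimes> x) \<one> (tvec z)"
proof
  fix f
  have "smooth_near M \<one> (\<lambda>x. f (g \<otimes> x))" if "smooth_near M g f"
    using smooth_near_compose[OF left_smooth[OF assms] one_closed] that assms by simp
  then show "left_field z g f = pushforward M (\<lambda>x. g \<otimes> x) \<one> (tvec z) f"
    using assms by (simp add: left_field_def pushforward_def tvec_def comp_def)
qed

lemma left_field_invariant:
  assumes "g \<in> carrier G" "h \<in> carrier G"
  shows "left_field z (g \<otimes> h) = pushforward M (\<lambda>x. g \<otimes> x) h (left_field z h)"
proof
  fix f :: "'g \<Rightarrow> real"
  have "frechet_derivative (\<lambda>x. f (g \<otimes> h \<otimes> ci x)) (at x0) = frechet_derivative (\<lambda>x. f (g \<otimes> (h \<otimes> ci x))) (at x0)"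
    by (rule frechet_derivative_cong_open[OF open_cU]) (use assms in \<open>auto simp: m_assoc\<close>)
  then show "left_field z (g \<otimes> h) f = pushforward M (\<lambda>x. g \<otimes> x) h (left_field z h) f"
    using assms smooth_near_compose[OF left_smooth[OF assms(1)] assms(2), of f]
    by (simp add: left_field_def pushforward_def comp_def)
qed

lemma left_field_tangent:
  assumes g: "g \<in> carrier G" shows "left_field z g \<in> tangent_space M g"
proof -
  obtain k \<epsilon> where k: "\<epsilon> > 0" "smooth_map (interval_mfd {-\<epsilon><..<\<epsilon>}) M k" "k 0 = \<one>"
    "((\<lambda>s. c (k s)) has_vector_derivative z) (at 0)" using curve_with_velocity .
  have v: "velocity M k 0 = tvec z" by (rule velocity_eq_tvec[OF _ _ k(2,3,4)]) (use k in auto)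
  have "left_field z g = velocity M (\<lambda>s. g \<otimes> k s) 0"
  proof
    fix f
    have "smooth_near M \<one> (\<lambda>x. f (g \<otimes> x))" if "smooth_near M g f"
      using smooth_near_compose[OF left_smooth[OF g] one_closed] that g by simp
    then show "left_field z g f = velocity M (\<lambda>s. g \<otimes> k s) 0 f"
      unfolding left_field_eq_pushforward[OF g] v[symmetric]
      using k(3) g by (simp add: pushforward_def velocity_def comp_def)
  qed
  moreover have "smooth_map (interval_mfd {-\<epsilon><..<\<epsilon>}) M (\<lambda>s. g \<otimes> k s)"
    by (rule smooth_map_compose[OF smooth_atlas_interval atlas atlas k(2) left_smooth[OF g]]) simp
  moreover have "g \<otimes> k 0 = g" using k(3) g by simp
  ultimately show ?thesis unfolding tangent_space_def mem_Collect_eq using k(1) by blast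
qed

text \<open>The first factor runs through an arbitrary chart, so that left-invariant fields can be
  studied at every point; the second stays in the chart at the identity, where their defining
  derivative is taken.\<close>

lemma mult_chart_smooth:
  assumes f: "smooth_vec_on M W f" and Vd: "(V, d) \<in> charts M"
  defines "P \<equiv> map_prod d c ` (V \<times> U \<inter> (\<lambda>(x, y). x \<otimes> y) -` W)"
  shows "open P" and "smooth_on P (\<lambda>p. f (inv_into V d (fst p) \<otimes> ci (snd p)))"
proof -
  note atl2 = smooth_atlas_prod[OF atlas atlas]
  have ch: "(V \<times> U, map_prod d c) \<in> charts (prod_mfd M M)"
    using Vd chart by (auto intro!: image_eqI[where x = "((V, d), (U, c))"])
  note sm = smooth_vec_on_compose[OF atl2 atlas mult_smooth f]
  have "V \<subseteq> carrier G" using smooth_atlas_chart(5)[OF atlas Vd] topspace_eq by simp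
  then have eq: "V \<times> U \<inter> (topspace (mtop (prod_mfd M M)) \<inter> (\<lambda>(x, y). x \<otimes> y) -` W) =
      V \<times> U \<inter> (\<lambda>(x, y). x \<otimes> y) -` W"
    using U_carrier topspace_eq by auto
  show P: "open P"
    using smooth_atlas_chart(3)[OF atl2 ch sm[unfolded smooth_vec_on_def, THEN conjunct1]]
    unfolding P_def eq .
  have s: "smooth_on P ((\<lambda>p. f (case p of (x, y) \<Rightarrow> x \<otimes> y)) \<circ> inv_into (V \<times> U) (map_prod d c))"
    using smooth_vec_on_chart[OF sm ch] unfolding P_def eq .
  have "((\<lambda>p. f (case p of (x, y) \<Rightarrow> x \<otimes> y)) \<circ> inv_into (V \<times> U) (map_prod d c)) p =
      f (inv_into V d (fst p) \<otimes> ci (snd p))" if "p \<in> P" for p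
  proof -
    have "p \<in> map_prod d c ` (V \<times> U)" using that by (auto simp: P_def)
    from inv_into_map_prod[OF smooth_atlas_chart(2)[OF atlas Vd] chart_props(2) this]
    show ?thesis by simp
  qed
  then show "smooth_on P (\<lambda>p. f (inv_into V d (fst p) \<otimes> ci (snd p)))"
    by (rule smooth_on_cong[OF P _ s])
qed

text \<open>The value of the field on \<open>f\<close> is a partial derivative, in the second
  variable, of \<open>f\<close> applied to a product. Joint smoothness of that function makes it
  smooth in the first variable.\<close>

lemma left_field_smooth:
  assumes f: "smooth_fun_on M W f" shows "smooth_fun_on M W (\<lambda>p. left_field z p f)"
proof -
  have W: "openin (mtop M) W" using f by (simp add: smooth_fun_on_def)
  have "smooth_on (d ` (V \<inter> W)) ((\<lambda>p. left_field z p f) \<circ> inv_into V d)"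
    if Vd: "(V, d) \<in> charts M" for V d
  proof -
    define P where "P = map_prod d c ` (V \<times> U \<inter> (\<lambda>(x, y). x \<otimes> y) -` W)"
    define h where "h = (\<lambda>p. f (inv_into V d (fst p) \<otimes> ci (snd p)))"
    have P: "open P" "smooth_on P h"
      using mult_chart_smooth[OF f[unfolded smooth_fun_on_eq] Vd] unfolding P_def h_def by auto
    note cV = smooth_atlas_chart[OF atlas Vd]
    have VW: "V \<subseteq> carrier G" using cV(5) topspace_eq by simp
    have S: "open (d ` (V \<inter> W))" by (rule cV(3)[OF W])
    have inP: "(y, x0) \<in> P" if "y \<in> d ` (V \<inter> W)" for y
    proof -
      obtain p where p: "p \<in> V" "p \<in> W" "y = d p" using \<open>y \<in> d ` (V \<inter> W)\<close> by auto
      then have "(p, \<one>) \<in> V \<times> U \<inter> (\<lambda>(x, y). x \<otimes> y) -` W" using one_in VW by auto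
      then show ?thesis unfolding P_def p(3) by force
    qed
    have s: "smooth_on (d ` (V \<inter> W)) (\<lambda>y. frechet_derivative h (at (y, x0)) (0, z))"
      by (rule smooth_on_frechet_derivative_compose[OF S P smooth_on_Pair[OF S smooth_on_ident[OF S] smooth_on_const[OF S]]])
         (use inP in auto)
    have "frechet_derivative h (at (y, x0)) (0, z) = ((\<lambda>p. left_field z p f) \<circ> inv_into V d) y"
      if y: "y \<in> d ` (V \<inter> W)" for y
    proof -
      have q: "inv_into V d y \<in> W" "inv_into V d y \<in> carrier G" using y cV(2) VW by auto
      then have "smooth_near M (inv_into V d y) f" using f by (auto simp: smooth_near_def)
      then have "left_field z (inv_into V d y) f = frechet_derivative (\<lambda>x. h (y, x)) (at x0) z"
        using q by (simp add: left_field_def h_def)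
      also have "\<dots> = frechet_derivative h (at (y, x0)) (0, z)"
        using frechet_derivative_at[OF frechet_derivative_partial(1)[OF P(2) inP[OF y]]]
        by (simp add: fun_eq_iff)
      finally show ?thesis by simp
    qed
    then show ?thesis by (rule smooth_on_cong[OF S _ s])
  qed
  then show ?thesis using W by (auto simp: smooth_fun_on_def)
qed

text \<open>A left-invariant field is determined on \<open>carrier G\<close> by its value at the
  identity, and off \<open>carrier G\<close> both sides are \<open>undefined\<close> by
  extensionality.\<close>

lemma lie_algebra_eq: "lie_algebra G M = range left_field"
proof (intro equalityI subsetI)
  fix X assume X: "X \<in> lie_algebra G M"
  then have E: "X \<in> (\<Pi>\<^sub>E p\<in>topspace (mtop M). tangent_space M p)"
    by (simp add: lie_algebra_def smooth_vector_field_def)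
  then have "X \<one> \<in> tangent_space M \<one>" using topspace_eq by auto
  then obtain z where z: "X \<one> = tvec z" using tangent_space_one by auto
  have "X g = left_field z g" for g
  proof (cases "g \<in> carrier G")
    case True
    from X have "\<forall>g\<in>carrier G. \<forall>h\<in>carrier G. X (g \<otimes> h) = pushforward M (\<lambda>x. g \<otimes> x) h (X h)"
      by (simp add: lie_algebra_def)
    from bspec[OF bspec[OF this True] one_closed]
    have "X g = pushforward M (\<lambda>x. g \<otimes> x) \<one> (tvec z)" by (simp only: r_one[OF True] z)
    then show ?thesis by (rule trans[OF _ left_field_eq_pushforward[OF True, symmetric]])
  next
    case False
    then have "X g = undefined" by (intro PiE_arb[OF E]) (simp add: topspace_eq)
    then show ?thesis using False by (simp add: left_field_def)
  qed
  then show "X \<in> range left_field" by auto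
next
  fix X assume "X \<in> range left_field"
  then obtain z where "X = left_field z" by auto
  moreover have "smooth_vector_field M (left_field z)"
    unfolding smooth_vector_field_def topspace_eq
    using left_field_tangent left_field_smooth by (auto simp: left_field_def)
  ultimately show "X \<in> lie_algebra G M"
    using left_field_invariant unfolding lie_algebra_def by blast
qed

end

section \<open>The adjoint representation\<close>

context lie_group_chart
begin

definition mult_c :: "'e \<times> 'e \<Rightarrow> 'e" where
  "mult_c p = c (ci (fst p) \<otimes> ci (snd p))"

definition mult_dom :: "('e \<times> 'e) set" where
  "mult_dom = map_prod c c ` (U \<times> U \<inter> (\<lambda>(x, y). x \<otimes> y) -` U)"

lemma mult_dom: "open mult_dom" "smooth_on mult_dom mult_c"
  using mult_chart_smooth[OF smooth_c chart] by (simp_all add: mult_dom_def mult_c_def[abs_def])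

lemma in_mult_dom:
  assumes "x \<in> c ` U" "y \<in> c ` U" "ci x \<otimes> ci y \<in> U" shows "(x, y) \<in> mult_dom"
proof -
  have "(x, y) = map_prod c c (ci x, ci y)" using assms by simp
  moreover have "(ci x, ci y) \<in> U \<times> U \<inter> (\<lambda>(x, y). x \<otimes> y) -` U" using assms ci_U by auto
  ultimately show ?thesis unfolding mult_dom_def by (rule image_eqI)
qed

lemma mult_c_one:
  assumes "x \<in> c ` U"
  shows "mult_c (x, x0) = x" "mult_c (x0, x) = x" "(x, x0) \<in> mult_dom" "(x0, x) \<in> mult_dom"
  using assms one_in by (auto simp: mult_c_def U_carrier intro!: in_mult_dom)

abbreviation "Dmult p \<equiv> frechet_derivative mult_c (at p)"

lemma Dmult_has_derivative: "p \<in> mult_dom \<Longrightarrow> (mult_c has_derivative Dmult p) (at p)"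
  by (rule smooth_on_has_derivative[OF mult_dom(2)])

lemma Dmult_linear: "p \<in> mult_dom \<Longrightarrow> linear (Dmult p)"
  by (rule has_derivative_linear[OF Dmult_has_derivative])

text \<open>The two unit laws differentiated. They hold along the whole chart and not only at
  \<open>x0\<close>, which allows differentiating them once more.\<close>

lemma Dmult_one:
  assumes "x \<in> c ` U"
  shows "Dmult (x, x0) (v, 0) = v" "Dmult (x0, x) (0, v) = v"
  using has_derivative_local_ident[OF frechet_derivative_partial(2)[OF mult_dom(2) mult_c_one(3)[OF assms]] open_cU assms]
    has_derivative_local_ident[OF frechet_derivative_partial(1)[OF mult_dom(2) mult_c_one(4)[OF assms]] open_cU assms]
    mult_c_one by blast+

text \<open>The mixed second derivative of multiplication at the identity, with \<open>z\<close> in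
  the first factor and \<open>w\<close> in the second. Equivalently, it is the derivative along
  \<open>z\<close> of the coordinate vector of \<open>left_field w\<close>, which is why its
  antisymmetrisation is the Lie bracket.\<close>

definition mixed :: "'e \<Rightarrow> 'e \<Rightarrow> 'e" where
  "mixed z w = frechet_derivative (\<lambda>x. Dmult (x, x0) (0, w)) (at x0) z"

definition bracket :: "'e \<Rightarrow> 'e \<Rightarrow> 'e" where
  "bracket z w = mixed z w - mixed w z"

lemma smooth_Dmult_slice: "smooth_on (c ` U) (\<lambda>x. Dmult (x, x0) v)"
  by (rule smooth_on_frechet_derivative_compose[OF open_cU mult_dom
        smooth_on_Pair[OF open_cU smooth_on_ident[OF open_cU] smooth_on_const[OF open_cU]]])
     (use mult_c_one in auto)

lemma mixed_has_derivative: "((\<lambda>x. Dmult (x, x0) (0, w)) has_derivative (\<lambda>z. mixed z w)) (at x0)"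
  unfolding mixed_def by (rule smooth_on_has_derivative[OF smooth_Dmult_slice x0_in])

lemma left_field_chart:
  assumes "x \<in> c ` U"
  shows "left_field w (ci x) (\<lambda>p. c p \<bullet> b) = Dmult (x, x0) (0, w) \<bullet> b"
proof -
  have "smooth_near M (ci x) (\<lambda>p. c p \<bullet> b)"
    using smooth_c_inner ci_U[OF assms] by (auto simp: smooth_near_def)
  then have "left_field w (ci x) (\<lambda>p. c p \<bullet> b) = frechet_derivative (\<lambda>y. mult_c (x, y) \<bullet> b) (at x0) w"
    using assms by (simp add: left_field_def mult_c_def)
  also have "\<dots> = Dmult (x, x0) (0, w) \<bullet> b"
    using fun_cong[OF frechet_derivative_at[OF bounded_linear.has_derivative[OF bounded_linear_inner_left
        frechet_derivative_partial(1)[OF mult_dom(2) mult_c_one(3)[OF assms]]]], symmetric] .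
  finally show ?thesis .
qed

lemma tvec_left_field: "tvec z (\<lambda>q. left_field w q (\<lambda>p. c p \<bullet> b)) = mixed z w \<bullet> b"
proof -
  have "smooth_near M \<one> (\<lambda>q. left_field w q (\<lambda>p. c p \<bullet> b))"
    using left_field_smooth[OF smooth_c_inner] one_in unfolding smooth_near_def by blast
  then have "tvec z (\<lambda>q. left_field w q (\<lambda>p. c p \<bullet> b)) =
      frechet_derivative (\<lambda>x. left_field w (ci x) (\<lambda>p. c p \<bullet> b)) (at x0) z"
    by (simp add: tvec_def)
  also have "\<dots> = frechet_derivative (\<lambda>x. Dmult (x, x0) (0, w) \<bullet> b) (at x0) z"
    by (rule fun_cong[OF frechet_derivative_cong_open[OF open_cU x0_in left_field_chart]])
  also have "\<dots> = mixed z w \<bullet> b"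
    using fun_cong[OF frechet_derivative_at[OF bounded_linear.has_derivative[OF bounded_linear_inner_left
        mixed_has_derivative]], symmetric] .
  finally show ?thesis .
qed

lemma vf_bracket_one:
  "vf_bracket M (left_field z) (left_field w) \<one> (\<lambda>p. c p \<bullet> b) = bracket z w \<bullet> b"
proof -
  have "smooth_near M \<one> (\<lambda>p. c p \<bullet> b)" using smooth_c_inner one_in unfolding smooth_near_def by blast
  then show ?thesis
    by (simp add: vf_bracket_def topspace_eq left_field_one tvec_left_field bracket_def inner_diff_left)
qed

text \<open>That the bracket of two left fields is again a left field is supplied by
  \<open>lie_algebra_iso\<close> where this is applied. Comparing coordinates at the identity is
  then enough.\<close>

lemma left_field_bracket_eq:
  assumes "left_field y = vf_bracket M (left_field z) (left_field w)" shows "y = bracket z w"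
proof (rule euclidean_eqI)
  fix b :: 'e
  have "y \<bullet> b = left_field y \<one> (\<lambda>p. c p \<bullet> b)" by (simp add: left_field_one tvec_inner)
  also have "\<dots> = bracket z w \<bullet> b" unfolding assms by (rule vf_bracket_one)
  finally show "y \<bullet> b = bracket z w \<bullet> b" .
qed

lemma left_field_inject: "left_field z = left_field w \<longleftrightarrow> z = w"
  using left_field_one tvec_inject by metis

definition Ad :: "'g \<Rightarrow> 'e \<Rightarrow> 'e" where
  "Ad g = frechet_derivative (\<lambda>x. c (g \<otimes> ci x \<otimes> inv g)) (at x0)"

lemma conj_smooth:
  assumes "g \<in> carrier G" shows "smooth_map M M (\<lambda>x. g \<otimes> x \<otimes> inv g)"
  by (rule smooth_map_compose[OF atlas atlas atlas left_smooth[OF assms] right_smooth[OF inv_closed[OF assms]]])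

lemma Ad_has_derivative:
  assumes "g \<in> carrier G"
  shows "((\<lambda>x. c (g \<otimes> ci x \<otimes> inv g)) has_derivative Ad g) (at x0)"
proof -
  have "x0 \<in> c ` (U \<inter> (\<lambda>x. g \<otimes> x \<otimes> inv g) -` U)" using one_in assms by auto
  from smooth_on_has_derivative[OF smooth_map_chart[OF conj_smooth[OF assms] chart chart] this]
  show ?thesis by (simp add: Ad_def comp_def)
qed

lemma Ad_linear: "g \<in> carrier G \<Longrightarrow> linear (Ad g)"
  by (rule has_derivative_linear[OF Ad_has_derivative])

lemma Ad_mult:
  assumes g: "g \<in> carrier G" and h: "h \<in> carrier G" shows "Ad (g \<otimes> h) z = Ad g (Ad h z)"
proof -
  let ?C = "\<lambda>g x. c (g \<otimes> ci x \<otimes> inv g)"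
  have "openin (mtop M) (topspace (mtop M) \<inter> (\<lambda>x. h \<otimes> x \<otimes> inv h) -` U)"
    by (rule smooth_map_preimage[OF conj_smooth[OF h] chart_props(1)])
  then have op: "open (c ` (U \<inter> (topspace (mtop M) \<inter> (\<lambda>x. h \<otimes> x \<otimes> inv h) -` U)))"
    by (rule chart_props(3))
  have "?C h x0 = x0" using h one_in by simp
  then have "((\<lambda>x. ?C g (?C h x)) has_derivative (\<lambda>z. Ad g (Ad h z))) (at x0)"
    using has_derivative_compose[OF Ad_has_derivative[OF h], of "?C g" "Ad g"] Ad_has_derivative[OF g] by simp
  then have "(?C (g \<otimes> h) has_derivative (\<lambda>z. Ad g (Ad h z))) (at x0)"
  proof (rule has_derivative_transform_within_open[OF _ op])
    show "x0 \<in> c ` (U \<inter> (topspace (mtop M) \<inter> (\<lambda>x. h \<otimes> x \<otimes> inv h) -` U))"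
      using one_in h topspace_eq by auto
    fix x assume "x \<in> c ` (U \<inter> (topspace (mtop M) \<inter> (\<lambda>x. h \<otimes> x \<otimes> inv h) -` U))"
    then obtain p where p: "p \<in> U" "h \<otimes> p \<otimes> inv h \<in> U" "x = c p" "p \<in> carrier G" using U_carrier by auto
    then show "?C g (?C h x) = ?C (g \<otimes> h) x"
      using g h by (simp add: inv_mult_group m_assoc)
  qed
  from fun_cong[OF has_derivative_unique[OF this Ad_has_derivative[OF m_closed[OF g h]]], of z]
  show ?thesis by simp
qed

lemma Ad_one: "Ad \<one> z = z"
  by (rule has_derivative_local_ident[OF Ad_has_derivative[OF one_closed] open_cU x0_in]) simp

lemma Ad_inv:
  assumes "g \<in> carrier G" shows "Ad (inv g) (Ad g z) = z" "Ad g (Ad (inv g) z) = z"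
  using Ad_mult[of "inv g" g] Ad_mult[of g "inv g"] assms by (simp_all add: Ad_one)

section \<open>Inversion in the chart and the derivative of \<open>Ad\<close> at the
  identity\<close>

definition inv_c :: "'e \<Rightarrow> 'e" where "inv_c x = c (inv (ci x))"

definition inv_dom :: "'e set" where "inv_dom = c ` (U \<inter> (topspace (mtop M) \<inter> (\<lambda>x. inv x) -` U))"

lemma inv_dom: "open inv_dom" "smooth_on inv_dom inv_c" "x0 \<in> inv_dom"
proof -
  show "open inv_dom" unfolding inv_dom_def
    by (rule chart_props(3)[OF smooth_map_preimage[OF inv_smooth chart_props(1)]])
  show "x0 \<in> inv_dom" using one_in topspace_eq by (auto simp: inv_dom_def)
  show "smooth_on inv_dom inv_c"
    using smooth_on_subset[OF smooth_map_chart[OF inv_smooth chart chart], of inv_dom]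
    by (auto simp: inv_dom_def inv_c_def[abs_def] comp_def)
qed

lemma inv_domD:
  assumes "x \<in> inv_dom"
  shows "x \<in> c ` U" "inv (ci x) \<in> U" "inv_c x \<in> c ` U" "ci (inv_c x) = inv (ci x)" "(x, inv_c x) \<in> mult_dom"
    "mult_c (x, inv_c x) = x0"
proof -
  show 1: "x \<in> c ` U" "inv (ci x) \<in> U" using assms by (auto simp: inv_dom_def)
  then show 2: "inv_c x \<in> c ` U" "ci (inv_c x) = inv (ci x)" by (simp_all add: inv_c_def)
  have 3: "ci x \<otimes> ci (inv_c x) = \<one>" unfolding 2(2) using 1(1) by simp
  show "(x, inv_c x) \<in> mult_dom" by (rule in_mult_dom) (simp_all add: 1 2(1) 3 one_in)
  show "mult_c (x, inv_c x) = x0" by (simp add: mult_c_def 3)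
qed

lemma inv_c_x0: "inv_c x0 = x0" using one_in by (simp add: inv_c_def)

text \<open>Differentiating \<open>mult_c (x, inv_c x) = x0\<close> at \<open>x0\<close> and
  splitting the argument by linearity gives \<open>z + ?i z = 0\<close>.\<close>

lemma inv_c_has_derivative: "(inv_c has_derivative uminus) (at x0)"
proof -
  let ?i = "frechet_derivative inv_c (at x0)"
  have i: "(inv_c has_derivative ?i) (at x0)" by (rule smooth_on_has_derivative[OF inv_dom(2,3)])
  have "((\<lambda>x. (x, inv_c x)) has_derivative (\<lambda>z. (z, ?i z))) (at x0)"
    by (intro has_derivative_Pair has_derivative_ident i)
  then have "((\<lambda>x. mult_c (x, inv_c x)) has_derivative (\<lambda>z. Dmult (x0, x0) (z, ?i z))) (at x0)"
    using has_derivative_compose[of "\<lambda>x. (x, inv_c x)" "\<lambda>z. (z, ?i z)" x0 UNIV mult_c "Dmult (x0, x0)"]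
      Dmult_has_derivative[OF mult_c_one(3)[OF x0_in]] inv_c_x0 by simp
  then have "Dmult (x0, x0) (z, ?i z) = 0" for z
    by (rule has_derivative_local_const[OF _ inv_dom(1,3)]) (rule inv_domD(6))
  moreover have "Dmult (x0, x0) (z, ?i z) = z + ?i z" for z
    using linear_add[OF Dmult_linear[OF mult_c_one(3)[OF x0_in]], of "(z, 0)" "(0, ?i z)"] Dmult_one[OF x0_in]
    by simp
  ultimately have "z + ?i z = 0" for z by simp
  then have "?i = uminus" by (auto simp: fun_eq_iff add_eq_0_iff)
  then show ?thesis using i by simp
qed

text \<open>Conjugation is left multiplication by \<open>ci x\<close> followed by right
  multiplication by its inverse, and for small arguments the intermediate product stays in the
  chart. The formula expresses \<open>Ad\<close> through derivatives of \<open>mult_c\<close>, which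
  can be differentiated in \<open>x\<close>.\<close>

lemma Ad_chart:
  assumes x: "x \<in> inv_dom"
  shows "Ad (ci x) w = Dmult (x, inv_c x) (Dmult (x, x0) (0, w), 0)"
proof -
  note xU = inv_domD(1)[OF x]
  define T where "T = {y \<in> c ` U. ci x \<otimes> ci y \<in> U}"
  have "T = c ` (U \<inter> (topspace (mtop M) \<inter> (\<lambda>y. ci x \<otimes> y) -` U))"
    using U_carrier topspace_eq by (auto simp: T_def)
  then have T: "open T"
    using chart_props(3)[OF smooth_map_preimage[OF left_smooth[OF ci_carrier[OF xU]] chart_props(1)]] by simp
  have x0T: "x0 \<in> T" using xU ci_U one_in by (simp add: T_def)
  note d1 = frechet_derivative_partial(1)[OF mult_dom(2) mult_c_one(3)[OF xU]]
  have "((\<lambda>y. mult_c (mult_c (x, y), inv_c x)) has_derivative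
      (\<lambda>w. Dmult (x, inv_c x) (Dmult (x, x0) (0, w), 0))) (at x0)"
    using has_derivative_compose[OF d1, of "\<lambda>t. mult_c (t, inv_c x)" "\<lambda>v. Dmult (x, inv_c x) (v, 0)"]
      frechet_derivative_partial(2)[OF mult_dom(2) inv_domD(5)[OF x]] mult_c_one(1)[OF xU] by simp
  then have "((\<lambda>y. c (ci x \<otimes> ci y \<otimes> inv (ci x))) has_derivative
      (\<lambda>w. Dmult (x, inv_c x) (Dmult (x, x0) (0, w), 0))) (at x0)"
  proof (rule has_derivative_transform_within_open[OF _ T x0T])
    fix y assume "y \<in> T"
    then show "mult_c (mult_c (x, y), inv_c x) = c (ci x \<otimes> ci y \<otimes> inv (ci x))"
      using inv_domD(4)[OF x] by (simp add: mult_c_def T_def)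
  qed
  from fun_cong[OF has_derivative_unique[OF Ad_has_derivative[OF ci_carrier[OF xU]] this], of w]
  show ?thesis .
qed

text \<open>The product rule for the formula of \<open>Ad_chart\<close>. The inner derivative
  contributes \<open>mixed z w\<close>. The outer one is differentiated along
  \<open>(z, - z)\<close>, the sign coming from inversion, and contributes
  \<open>- mixed w z\<close>.\<close>

lemma Ad_ci_has_derivative: "((\<lambda>x. Ad (ci x) w) has_derivative (\<lambda>z. bracket z w)) (at x0)"
proof -
  have P0: "(x0, x0) \<in> mult_dom" by (rule mult_c_one(3)[OF x0_in])
  have mixed_lin: "linear (\<lambda>z. mixed z w)" for w by (rule has_derivative_linear[OF mixed_has_derivative])
  define A where "A b p = Dmult p (b, 0)" for b p
  define A' where "A' b = frechet_derivative (A b) (at (x0, x0))" for b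
  have smA: "smooth_on mult_dom (A b)" for b
    unfolding A_def[abs_def] by (rule smooth_on_frechet_derivative[OF mult_dom(2)])
  have A: "(A b has_derivative A' b) (at (x0, x0))" for b
    unfolding A'_def by (rule smooth_on_has_derivative[OF smA P0])
  \<comment> \<open>Along the first factor with the second one fixed at \<open>x0\<close>,
    \<open>A b\<close> has the constant value \<open>b\<close> by \<open>Dmult_one\<close>.\<close>
  have A1: "A' b (v, 0) = 0" for b v
    unfolding A'_def
    by (rule has_derivative_local_const[OF frechet_derivative_partial(2)[OF smA P0] open_cU x0_in])
       (simp add: A_def Dmult_one)
  \<comment> \<open>\<open>mixed\<close> differentiates in the second factor before the first,
    \<open>A'\<close> in the opposite order; symmetry of second derivatives exchanges them.\<close>
  have A2: "A' b (0, v) = mixed b v" for b v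
  proof -
    have "A' b (0, v) = frechet_derivative (\<lambda>p. Dmult p (0, v)) (at (x0, x0)) (b, 0)"
      unfolding A'_def A_def[abs_def] by (rule second_derivative_symmetric[OF mult_dom P0])
    also have "\<dots> = mixed b v"
      unfolding mixed_def
      by (rule fun_cong[OF frechet_derivative_at[OF frechet_derivative_partial(2)[OF
            smooth_on_frechet_derivative[OF mult_dom(2)] P0]]])
    finally show ?thesis .
  qed
  have A3: "A' b (z, - z) = - mixed b z" for b z
    using linear_add[OF has_derivative_linear[OF A], of b "(z, 0)" "(0, - z)"]
      linear_neg[OF has_derivative_linear[OF A], of b "(0, z)"] A1 A2 by simp
  have pair: "((\<lambda>x. (x, inv_c x)) has_derivative (\<lambda>z. (z, - z))) (at x0)"
    by (intro has_derivative_Pair has_derivative_ident inv_c_has_derivative)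
  have Ai: "((\<lambda>x. A b (x, inv_c x)) has_derivative (\<lambda>z. - mixed b z)) (at x0)" for b
    using has_derivative_compose[OF pair, of "A b" "A' b"] A[of b] by (simp add: inv_c_x0 A3)
  let ?u = "\<lambda>x. Dmult (x, x0) (0, w)"
  have ui: "((\<lambda>x. ?u x \<bullet> b) has_derivative (\<lambda>z. mixed z w \<bullet> b)) (at x0)" for b
    by (rule bounded_linear.has_derivative[OF bounded_linear_inner_left mixed_has_derivative])
  \<comment> \<open>Expansion in the basis again separates the base point of the outer derivative
    from its argument, so the ordinary product rule applies.\<close>
  have "((\<lambda>x. \<Sum>b\<in>Basis. (?u x \<bullet> b) *\<^sub>R A b (x, inv_c x)) has_derivative
      (\<lambda>z. \<Sum>b\<in>Basis. (?u x0 \<bullet> b) *\<^sub>R (- mixed b z) + (mixed z w \<bullet> b) *\<^sub>R A b (x0, inv_c x0))) (at x0)"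
    by (intro has_derivative_sum has_derivative_scaleR ui Ai)
  moreover have "(\<Sum>b\<in>Basis. (?u x0 \<bullet> b) *\<^sub>R (- mixed b z) + (mixed z w \<bullet> b) *\<^sub>R A b (x0, inv_c x0)) = bracket z w" for z
  proof -
    have "(\<Sum>b\<in>Basis. (w \<bullet> b) *\<^sub>R mixed b z) = mixed w z"
      by (rule linear_basis_sum[OF mixed_lin, symmetric])
    moreover have "(\<Sum>b\<in>Basis. (mixed z w \<bullet> b) *\<^sub>R b) = mixed z w" by (rule euclidean_representation)
    moreover have "?u x0 = w" "A b (x0, inv_c x0) = b" for b
      by (simp_all add: Dmult_one A_def inv_c_x0)
    ultimately show ?thesis by (simp add: sum_subtractf bracket_def)
  qed
  ultimately have "((\<lambda>x. \<Sum>b\<in>Basis. (?u x \<bullet> b) *\<^sub>R A b (x, inv_c x)) has_derivative (\<lambda>z. bracket z w)) (at x0)"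
    by simp
  then show ?thesis
  proof (rule has_derivative_transform_within_open[OF _ inv_dom(1,3)])
    fix x assume x: "x \<in> inv_dom"
    have "linear (\<lambda>v. Dmult (x, inv_c x) (v, 0))"
      by (rule has_derivative_linear[OF frechet_derivative_partial(2)[OF mult_dom(2) inv_domD(5)[OF x]]])
    from linear_basis_sum[OF this, of "?u x"]
    show "(\<Sum>b\<in>Basis. (?u x \<bullet> b) *\<^sub>R A b (x, inv_c x)) = Ad (ci x) w"
      unfolding Ad_chart[OF x] A_def by (rule sym)
  qed
qed

lemma Ad_inv_ci_has_derivative: "((\<lambda>x. Ad (inv (ci x)) w) has_derivative (\<lambda>z. - bracket z w)) (at x0)"
proof -
  have lin: "linear (\<lambda>z. bracket z w)" by (rule has_derivative_linear[OF Ad_ci_has_derivative])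
  have "((\<lambda>x. Ad (ci (inv_c x)) w) has_derivative (\<lambda>z. bracket (- z) w)) (at x0)"
    using has_derivative_compose[OF inv_c_has_derivative, of "\<lambda>x. Ad (ci x) w" "\<lambda>z. bracket z w"]
      Ad_ci_has_derivative by (simp add: inv_c_x0)
  then have "((\<lambda>x. Ad (inv (ci x)) w) has_derivative (\<lambda>z. bracket (- z) w)) (at x0)"
    by (rule has_derivative_transform_within_open[OF _ inv_dom(1,3)]) (simp add: inv_domD(4))
  then show ?thesis using linear_neg[OF lin] by simp
qed

end

section \<open>Connected subgroups and exponentials\<close>

context lie_group_chart
begin

text \<open>In \<open>connected_lie_subgroup\<close> the subalgebra is described by pushed forward
  tangent vectors. Here this becomes a criterion on the chart derivative of curves that are smooth
  for \<open>MH\<close>.\<close>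

lemma left_field_in_subalgebra:
  assumes H: "connected_lie_subgroup G M \<hh> H MH"
    and I: "\<epsilon> > 0" and k: "smooth_map (interval_mfd {-\<epsilon><..<\<epsilon>}) MH k" "k 0 = \<one>"
    and z: "((\<lambda>s. c (k s)) has_vector_derivative z) (at 0)"
  shows "left_field z \<in> \<hh>"
proof -
  have LH: "lie_group (G\<lparr>carrier := H\<rparr>) MH" and id: "smooth_map MH M id"
    and hh: "\<hh> = {X \<in> lie_algebra G M. X \<one> \<in> pushforward M id \<one> ` tangent_space MH \<one>}"
    and sub: "subgroup H G"
    using H unfolding connected_lie_subgroup_def by blast+
  note atlH = lie_group_atlas[OF LH]
  have top: "topspace (mtop MH) = H" using lie_group_topspace[OF LH] by simp
  let ?I = "{-\<epsilon><..<\<epsilon>}"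
  have kM: "smooth_map (interval_mfd ?I) M k"
    using smooth_map_compose[OF smooth_atlas_interval atlH atlas k(1) id] by simp
  have "velocity MH k 0 \<in> tangent_space MH \<one>"
    unfolding tangent_space_def mem_Collect_eq using I k by blast
  moreover have "pushforward M id \<one> (velocity MH k 0) = tvec z"
  proof -
    have "velocity M k 0 = tvec z" by (rule velocity_eq_tvec[OF _ _ kM k(2) z]) (use I in auto)
    moreover have "pushforward M id \<one> (velocity MH k 0) f = velocity M k 0 f" for f
    proof -
      \<comment> \<open>Without this \<open>velocity MH k 0\<close> would take its default value 0
        on \<open>f \<circ> id\<close>.\<close>
      have "smooth_near MH \<one> (f \<circ> id)" if "smooth_near M \<one> f"
      proof -
        from that obtain W where W: "\<one> \<in> W" "smooth_vec_on M W f"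
          by (auto simp: smooth_near_def smooth_fun_on_eq)
        have "\<one> \<in> topspace (mtop MH) \<inter> id -` W" using W(1) subgroup.one_closed[OF sub] top by simp
        with smooth_vec_on_compose[OF atlH atlas id W(2)] show ?thesis
          unfolding smooth_near_def smooth_fun_on_eq comp_def by (intro exI conjI)
      qed
      then show ?thesis by (simp add: pushforward_def velocity_def k(2))
    qed
    ultimately show ?thesis by (simp add: fun_eq_iff)
  qed
  ultimately have "left_field z \<one> \<in> pushforward M id \<one> ` tangent_space MH \<one>"
    unfolding left_field_one by (metis imageI)
  then show ?thesis unfolding hh using lie_algebra_eq by simp
qed

text \<open>Near \<open>q\<close> a point \<open>p\<close> of \<open>H\<close> is written as
  \<open>q\<close> times \<open>inv q \<otimes> p\<close>, and the second factor moves through the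
  identity inside \<open>H\<close>. Its velocities therefore lie in \<open>\<hh>\<close>, so
  \<open>F\<close> has derivative zero in the charts of \<open>MH\<close> and is locally constant on
  \<open>H\<close>.\<close>

lemma connected_subgroup_constant:
  fixes F :: "'g \<Rightarrow> 'b::real_normed_vector" and MH :: "('g, 'h::euclidean_space) mfd"
  assumes H: "connected_lie_subgroup G M \<hh> H MH"
    and F: "\<And>q. q \<in> H \<Longrightarrow> \<exists>F'. ((\<lambda>x. F (q \<otimes> ci x)) has_derivative F') (at x0) \<and>
               (\<forall>z. left_field z \<in> \<hh> \<longrightarrow> F' z = 0)"
    and h: "h \<in> H"
  shows "F h = F \<one>"
proof -
  have LH: "lie_group (G\<lparr>carrier := H\<rparr>) MH" and id: "smooth_map MH M id" and sub: "subgroup H G"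
    and conn: "connected_space (mtop MH)"
    using H unfolding connected_lie_subgroup_def by blast+
  note atlH = lie_group_atlas[OF LH] and manH = lie_group_manifold[OF LH]
  have top: "topspace (mtop MH) = H" using lie_group_topspace[OF LH] by simp
  have HG: "x \<in> carrier G" if "x \<in> H" for x using that sub by (rule subgroup.mem_carrier[rotated])
  have lmH: "smooth_map MH MH (\<lambda>x. q \<otimes> x)" if "q \<in> H" for q
    using lie_group_left_mult[OF LH, of q] that by simp
  have lm: "smooth_map MH M (\<lambda>x. q \<otimes> x)" if "q \<in> H" for q
    using smooth_map_compose[OF atlH atlH atlas lmH[OF that] id] by simp
  have deriv: "((\<lambda>y. F (inv_into V d y)) has_derivative (\<lambda>e. 0)) (at y)"
    if Vd: "(V, d) \<in> charts MH" and y: "y \<in> d ` V" for V d y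
  proof -
    note cV = smooth_atlas_chart[OF atlH Vd]
    define q where "q = inv_into V d y"
    have qV: "q \<in> V" and dq: "d q = y" using y by (auto simp: q_def inv_into_into f_inv_into_f)
    have VH: "V \<subseteq> H" using cV(5) top by simp
    have qH: "q \<in> H" using qV VH by blast
    then have iqH: "inv q \<in> H" using subgroup.m_inv_closed[OF sub] by blast
    note qG = HG[OF qH]
    define S where "S = d ` (V \<inter> (topspace (mtop MH) \<inter> (\<lambda>x. inv q \<otimes> x) -` U))"
    have S: "open S" unfolding S_def
      by (rule cV(3)[OF smooth_map_preimage[OF lm[OF iqH] chart_props(1)]])
    have yS: "y \<in> S" unfolding S_def using qV qH dq top qG one_in by (force intro!: image_eqI[of y d q])
    \<comment> \<open>The coordinates, in the chart of \<open>G\<close> at the identity, of the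
      factor \<open>inv q \<otimes> p\<close>, as a function of the coordinates of \<open>p\<close>
      in the chart of \<open>MH\<close>.\<close>
    define \<eta> where "\<eta> = (\<lambda>y. c (inv q \<otimes> inv_into V d y))"
    have "smooth_on S \<eta>"
      using smooth_on_subset[OF smooth_map_chart[OF lm[OF iqH] Vd chart], of S]
      by (auto simp: S_def \<eta>_def comp_def)
    then have \<eta>: "(\<eta> has_derivative frechet_derivative \<eta> (at y)) (at y)"
      using yS by (rule smooth_on_has_derivative)
    have \<eta>y: "\<eta> y = x0" using qG by (simp add: \<eta>_def q_def[symmetric])
    let ?D = "frechet_derivative \<eta> (at y)"
    have in_h: "left_field (?D e) \<in> \<hh>" for e
    proof -
      have "open ((\<lambda>s::real. y + s *\<^sub>R e) -` (d ` V))"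
        by (rule open_vimage[OF cV(6)]) (intro continuous_intros)
      moreover have "0 \<in> (\<lambda>s::real. y + s *\<^sub>R e) -` (d ` V)" using y by simp
      ultimately obtain \<epsilon> where e: "\<epsilon> > 0" "ball 0 \<epsilon> \<subseteq> (\<lambda>s::real. y + s *\<^sub>R e) -` (d ` V)"
        using open_contains_ball by blast
      have b: "ball 0 \<epsilon> = {-\<epsilon><..<\<epsilon>}" by (auto simp: dist_real_def)
      have c1: "smooth_map (interval_mfd {-\<epsilon><..<\<epsilon>}) MH (\<lambda>s. inv_into V d (y + s *\<^sub>R e))"
        by (rule smooth_map_chart_curve[OF manH Vd]) (use e b in auto)
      have c2: "smooth_map (interval_mfd {-\<epsilon><..<\<epsilon>}) MH (\<lambda>s. inv q \<otimes> inv_into V d (y + s *\<^sub>R e))"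
        by (rule smooth_map_compose[OF smooth_atlas_interval atlH atlH c1 lmH[OF iqH]]) simp
      have "((\<lambda>s. y + s *\<^sub>R e) has_derivative (\<lambda>s. s *\<^sub>R e)) (at 0)"
        by (auto intro!: derivative_eq_intros)
      then have "((\<lambda>s. \<eta> (y + s *\<^sub>R e)) has_derivative (\<lambda>s. ?D (s *\<^sub>R e))) (at 0)"
        using has_derivative_compose[of "\<lambda>s. y + s *\<^sub>R e" "\<lambda>s. s *\<^sub>R e" 0 UNIV \<eta> ?D] \<eta> by simp
      then have "((\<lambda>s. \<eta> (y + s *\<^sub>R e)) has_vector_derivative ?D e) (at 0)"
        by (simp add: has_vector_derivative_def linear_cmul[OF has_derivative_linear[OF \<eta>]])
      then have "((\<lambda>s. c (inv q \<otimes> inv_into V d (y + s *\<^sub>R e))) has_vector_derivative ?D e) (at 0)"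
        by (simp add: \<eta>_def)
      then show ?thesis
        by (rule left_field_in_subalgebra[OF H e(1) c2, rotated]) (simp add: q_def[symmetric] qG)
    qed
    obtain F' where F': "((\<lambda>x. F (q \<otimes> ci x)) has_derivative F') (at x0)" "\<forall>z. left_field z \<in> \<hh> \<longrightarrow> F' z = 0"
      using F[OF qH] by blast
    have "((\<lambda>y. F (q \<otimes> ci (\<eta> y))) has_derivative (\<lambda>e. F' (?D e))) (at y)"
      using has_derivative_compose[OF \<eta>, of "\<lambda>x. F (q \<otimes> ci x)" F'] F'(1) \<eta>y by simp
    moreover have "(\<lambda>e. F' (?D e)) = (\<lambda>e. 0)" using F'(2) in_h by simp
    ultimately have "((\<lambda>y. F (q \<otimes> ci (\<eta> y))) has_derivative (\<lambda>e. 0)) (at y)" by simp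
    then show ?thesis
    proof (rule has_derivative_transform_within_open[OF _ S yS])
      fix y' assume "y' \<in> S"
      then obtain p where p: "p \<in> V" "inv q \<otimes> p \<in> U" "y' = d p" by (auto simp: S_def)
      then have "p \<in> carrier G" using VH HG by blast
      then show "F (q \<otimes> ci (\<eta> y')) = F (inv_into V d y')"
        using p cV(2) qG by (simp add: \<eta>_def m_assoc[symmetric])
    qed
  qed
  show ?thesis
  proof (rule connected_space_locally_constant[OF conn])
    show "h \<in> topspace (mtop MH)" "\<one> \<in> topspace (mtop MH)" using h subgroup.one_closed[OF sub] top by simp_all
    fix p assume "p \<in> topspace (mtop MH)"
    then obtain V d where Vd: "(V, d) \<in> charts MH" "p \<in> V" by (rule smooth_atlas_cover[OF atlH])
    note cV = smooth_atlas_chart[OF atlH Vd(1)]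
    obtain r where r: "r > 0" "ball (d p) r \<subseteq> d ` V" using cV(6) Vd(2) open_contains_ball by blast
    have "F q = F p" if "q \<in> V \<inter> d -` ball (d p) r" for q
    proof -
      have "F (inv_into V d (d q)) = F (inv_into V d (d p))"
        by (rule has_derivative_zero_unique_connected[where f = "\<lambda>y. F (inv_into V d y)",
              OF open_ball connected_ball deriv[OF Vd(1)]]) (use r that in auto)
      then show ?thesis using that Vd(2) cV(2) by simp
    qed
    moreover have "p \<in> V \<inter> d -` ball (d p) r" using Vd(2) r(1) by simp
    ultimately show "\<exists>W. openin (mtop MH) W \<and> p \<in> W \<and> (\<forall>q\<in>W. F q = F p)"
      using cV(4)[OF open_ball[of "d p" r]] by blast
  qed
qed

section \<open>One-parameter subgroups and the exponential series\<close>

lemma one_parameter_subgroup: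
  assumes \<gamma>: "smooth_map (interval_mfd UNIV) M \<gamma>" and hom: "\<And>s t. \<gamma> (s + t) = \<gamma> s \<otimes> \<gamma> t"
  shows "\<gamma> t \<in> carrier G" "\<gamma> 0 = \<one>"
proof -
  show cl: "\<gamma> t \<in> carrier G" for t
    using smooth_map_in_topspace[OF \<gamma>, of t] topspace_eq by simp
  have "\<gamma> 0 = \<gamma> 0 \<otimes> \<gamma> 0" using hom[of 0 0] by simp
  then show "\<gamma> 0 = \<one>" using cl[of 0] by (metis l_cancel_one')
qed

text \<open>Writing \<open>\<gamma> s\<close> as
  \<open>\<gamma> t \<otimes> \<gamma> (s - t)\<close> reduces the derivative at \<open>t\<close> to
  the one at the identity, followed by the linear map \<open>Ad (\<gamma> t)\<close>.\<close>

lemma Ad_one_parameter_subgroup: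
  assumes \<gamma>: "smooth_map (interval_mfd UNIV) M \<gamma>" and hom: "\<And>s t. \<gamma> (s + t) = \<gamma> s \<otimes> \<gamma> t"
    and z: "velocity M \<gamma> 0 = tvec z"
  shows "((\<lambda>s. Ad (\<gamma> s) w) has_vector_derivative Ad (\<gamma> t) (bracket z w)) (at t)"
proof -
  note g = one_parameter_subgroup[OF \<gamma> hom]
  let ?v = "vector_derivative (\<lambda>s. c (\<gamma> s)) (at 0)"
  have v: "((\<lambda>s. c (\<gamma> s)) has_vector_derivative ?v) (at 0)"
    by (rule curve_differentiable[OF open_UNIV \<gamma>]) (simp_all add: g one_in)
  have "velocity M \<gamma> 0 = tvec ?v" by (rule velocity_eq_tvec[OF open_UNIV _ \<gamma> g(2) v]) simp
  then have "?v = z" using z tvec_inject by metis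
  then have "((\<lambda>s. Ad (\<gamma> s) w) has_vector_derivative bracket z w) (at 0)"
    using curve_has_derivative[OF open_UNIV _ _ g(2) v Ad_ci_has_derivative[of w]]
      smooth_map_continuous[OF \<gamma>] by simp
  then have "((\<lambda>s. Ad (\<gamma> s) w) has_derivative (\<lambda>h. h *\<^sub>R bracket z w)) (at (t - t))"
    by (simp add: has_vector_derivative_def)
  moreover have "((\<lambda>s. s - t) has_derivative (\<lambda>h. h)) (at t)"
    by (auto intro!: derivative_eq_intros)
  ultimately have "((\<lambda>s. Ad (\<gamma> (s - t)) w) has_derivative (\<lambda>h. h *\<^sub>R bracket z w)) (at t)"
    by (rule has_derivative_compose[rotated])
  then have "((\<lambda>s. Ad (\<gamma> t) (Ad (\<gamma> (s - t)) w)) has_derivative (\<lambda>h. Ad (\<gamma> t) (h *\<^sub>R bracket z w))) (at t)"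
    using bounded_linear.has_derivative[OF Ad_linear[OF g(1), unfolded linear_conv_bounded_linear]] by blast
  moreover have "Ad (\<gamma> t) (Ad (\<gamma> (s - t)) w) = Ad (\<gamma> s) w" for s
    using Ad_mult[OF g(1) g(1), of t "s - t" w] hom[of t "s - t"] by simp
  ultimately show ?thesis
    by (simp add: has_vector_derivative_def linear_cmul[OF Ad_linear[OF g(1)]])
qed

text \<open>The hypothesis makes \<open>p k\<close> the \<open>k\<close>-th term of the exponential
  series of \<open>ad z\<close> at \<open>p 0\<close>. The function \<open>r\<close> is
  \<open>Ad (\<gamma> t)\<close> applied to the series with parameter \<open>- t\<close>; it is
  constant because these two maps are inverse to each other.\<close>

lemma Ad_exp_nilpotent:
  assumes exp: "is_lie_exp G M (left_field z) g"
    and p: "\<And>k. k \<le> n \<Longrightarrow> bracket z (p k) = real (Suc k) *\<^sub>R p (Suc k)" and pn: "p (Suc n) = 0"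
  shows "Ad g (p 0) = (\<Sum>k\<le>n. p k)"
proof -
  obtain \<gamma> where \<gamma>: "smooth_map (interval_mfd UNIV) M \<gamma>" and hom: "\<And>s t. \<gamma> (s + t) = \<gamma> s \<otimes> \<gamma> t"
    and v: "velocity M \<gamma> 0 = tvec z" and g: "\<gamma> 1 = g"
    using exp unfolding is_lie_exp_def left_field_one by blast
  note \<gamma>c = one_parameter_subgroup[OF \<gamma> hom]
  define r where "r t = (\<Sum>k\<le>n. (- t) ^ k *\<^sub>R Ad (\<gamma> t) (p k))" for t
  have "(r has_vector_derivative 0) (at t)" for t
  proof -
    \<comment> \<open>The derivative of the \<open>k\<close>-th summand is
      \<open>b (Suc k) - b k\<close>, so the sum telescopes. The truncated exponent at
      \<open>k = 0\<close> is harmless because of the factor \<open>real k\<close>.\<close>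
    define b where "b k = (real k * (- t) ^ (k - 1)) *\<^sub>R Ad (\<gamma> t) (p k)" for k
    have "((\<lambda>t. (- t) ^ k *\<^sub>R Ad (\<gamma> t) (p k)) has_vector_derivative b (Suc k) - b k) (at t)"
      if "k \<le> n" for k
    proof -
      have "((\<lambda>t::real. (- t) ^ k) has_field_derivative - (real k * (- t) ^ (k - 1))) (at t)"
        by (auto intro!: derivative_eq_intros)
      from has_vector_derivative_scaleR[OF this Ad_one_parameter_subgroup[OF \<gamma> hom v, of "p k" t]]
      show ?thesis
        by (simp add: p[OF that] b_def linear_cmul[OF Ad_linear[OF \<gamma>c(1)]] mult.commute)
    qed
    then have "(r has_vector_derivative (\<Sum>k\<le>n. b (Suc k) - b k)) (at t)"
      unfolding r_def[abs_def] by (intro has_vector_derivative_sum) simp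
    moreover have "(\<Sum>k\<le>n. b (Suc k) - b k) = b (Suc n) - b 0"
      using sum_lessThan_telescope[of b "Suc n"] by (simp only: lessThan_Suc_atMost)
    moreover have "b (Suc n) = 0" "b 0 = 0"
      by (simp_all add: b_def pn linear_0[OF Ad_linear[OF \<gamma>c(1)]])
    ultimately show ?thesis by simp
  qed
  then obtain a where "\<And>t. r t = a" by (rule has_vector_derivative_zero_constant[OF convex_UNIV]) blast
  \<comment> \<open>At \<open>t = -1\<close> all coefficients \<open>(- t) ^ k\<close> are 1, and at
    \<open>t = 0\<close> only the term \<open>p 0\<close> survives.\<close>
  then have "r (-1) = r 0" by simp
  moreover have "r 0 = p 0"
    unfolding r_def using \<gamma>c(2) by (subst sum.remove[of _ 0]) (auto simp: Ad_one power_0_left)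
  moreover have "r (-1) = Ad (\<gamma> (-1)) (\<Sum>k\<le>n. p k)"
    by (simp add: r_def linear_sum[OF Ad_linear[OF \<gamma>c(1)]])
  ultimately have "Ad (\<gamma> (-1)) (\<Sum>k\<le>n. p k) = p 0" by simp
  then have "Ad (\<gamma> 1) (p 0) = Ad (\<gamma> 1 \<otimes> \<gamma> (-1)) (\<Sum>k\<le>n. p k)"
    by (simp add: Ad_mult[OF \<gamma>c(1) \<gamma>c(1)])
  also have "\<gamma> 1 \<otimes> \<gamma> (-1) = \<one>" using hom[of 1 "-1"] \<gamma>c(2) by simp
  finally show ?thesis by (simp add: g Ad_one)
qed

end

section \<open>Transport to an algebraic model of the Lie algebra\<close>

locale lie_group_model = lie_group_chart G M U c
  for G :: "('g, 'm) monoid_scheme" (structure)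
    and M :: "('g, 'e::euclidean_space) mfd" and U c +
  fixes \<gg> :: "'v::euclidean_space set" and br :: "'v \<Rightarrow> 'v \<Rightarrow> 'v"
    and \<phi> :: "'v \<Rightarrow> 'g \<Rightarrow> ('g \<Rightarrow> real) \<Rightarrow> real"
  assumes iso: "lie_algebra_iso \<gg> br G M \<phi>" and subspace: "subspace \<gg>"
    and br_closed: "\<And>X Y. X \<in> \<gg> \<Longrightarrow> Y \<in> \<gg> \<Longrightarrow> br X Y \<in> \<gg>"
begin

text \<open>Identifies chart coordinates of the tangent space at the identity with
  \<open>\<gg>\<close>. It is a linear bijection carrying \<open>bracket\<close> to
  \<open>br\<close>, so statements about \<open>Ad\<close> can be computed in
  \<open>\<gg>\<close>.\<close>

definition model :: "'e \<Rightarrow> 'v" where "model z = inv_into \<gg> \<phi> (left_field z)"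

lemma phi_bij: "bij_betw \<phi> \<gg> (range left_field)"
  using iso lie_algebra_eq by (simp add: lie_algebra_iso_def)

lemma model: "model z \<in> \<gg>" "\<phi> (model z) = left_field z"
proof -
  have "left_field z \<in> \<phi> ` \<gg>" using phi_bij by (simp add: bij_betw_def)
  then show "model z \<in> \<gg>" "\<phi> (model z) = left_field z"
    unfolding model_def by (rule inv_into_into, rule f_inv_into_f)
qed

lemma phi_inject: "X \<in> \<gg> \<Longrightarrow> Y \<in> \<gg> \<Longrightarrow> \<phi> X = \<phi> Y \<longleftrightarrow> X = Y"
  using phi_bij by (auto simp: bij_betw_def inj_on_def)

lemma model_eqI: "X \<in> \<gg> \<Longrightarrow> \<phi> X = left_field z \<Longrightarrow> model z = X"
  using phi_inject[OF model(1)] model(2) by metis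

lemma model_surj:
  assumes "X \<in> \<gg>" obtains z where "model z = X" "\<phi> X = left_field z"
proof -
  have "\<phi> X \<in> range left_field" using phi_bij assms by (auto simp: bij_betw_def)
  then obtain z where "\<phi> X = left_field z" by auto
  then show ?thesis using that model_eqI[OF assms] by blast
qed

lemma model_in_image: "\<hh> \<subseteq> \<gg> \<Longrightarrow> left_field z \<in> \<phi> ` \<hh> \<Longrightarrow> model z \<in> \<hh>"
  using model_eqI by (metis imageE subsetD)

text \<open>\<open>lie_algebra_iso\<close> states linearity pointwise on functionals; evaluating at
  the identity on chart coordinates turns it into linearity between vectors.\<close>

lemma model_lincomb: "model (a *\<^sub>R z + b *\<^sub>R w) = a *\<^sub>R model z + b *\<^sub>R model w"
proof (rule model_eqI)
  let ?X = "a *\<^sub>R model z + b *\<^sub>R model w"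
  show X: "?X \<in> \<gg>" using subspace model(1) by (simp add: subspace_add subspace_scale)
  obtain y where y: "\<phi> ?X = left_field y" using model_surj[OF X] by blast
  have "y \<bullet> i = (a *\<^sub>R z + b *\<^sub>R w) \<bullet> i" for i
  proof -
    have "\<forall>X\<in>\<gg>. \<forall>Y\<in>\<gg>. \<forall>a b. \<forall>p\<in>carrier G. \<forall>f.
        \<phi> (a *\<^sub>R X + b *\<^sub>R Y) p f = a * \<phi> X p f + b * \<phi> Y p f"
      using iso unfolding lie_algebra_iso_def by (elim conjE)
    then have "\<phi> ?X \<one> (\<lambda>p. c p \<bullet> i) = a * \<phi> (model z) \<one> (\<lambda>p. c p \<bullet> i) + b * \<phi> (model w) \<one> (\<lambda>p. c p \<bullet> i)"
      using model(1) one_closed by blast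
    then show ?thesis
      by (simp add: y model(2) left_field_one tvec_inner inner_add_left)
  qed
  then have "y = a *\<^sub>R z + b *\<^sub>R w" by (rule euclidean_eqI)
  then show "\<phi> ?X = left_field (a *\<^sub>R z + b *\<^sub>R w)" using y by simp
qed

lemma model_linear: "linear model"
  using model_lincomb[of 1 _ 1] model_lincomb[of _ _ 0 0]
  by (intro linearI) simp_all

lemma model_inject: "model z = model w \<longleftrightarrow> z = w"
  using model(2) left_field_inject by metis

lemma model_bracket: "model (bracket z w) = br (model z) (model w)"
proof -
  have X: "br (model z) (model w) \<in> \<gg>" by (intro br_closed model)
  obtain y where y: "model y = br (model z) (model w)" "\<phi> (br (model z) (model w)) = left_field y"
    using model_surj[OF X] by metis
  have "\<forall>X\<in>\<gg>. \<forall>Y\<in>\<gg>. \<phi> (br X Y) = vf_bracket M (\<phi> X) (\<phi> Y)"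
    using iso unfolding lie_algebra_iso_def by (elim conjE)
  then have "left_field y = vf_bracket M (left_field z) (left_field w)"
    using model y(2) by metis
  from left_field_bracket_eq[OF this] y(1) show ?thesis by simp
qed

text \<open>The line is tracked by its unit vector \<open>F g\<close>. If the derivative of a vector
  is a multiple of that vector, the derivative of its normalisation vanishes, so \<open>F\<close> is
  constant on \<open>H\<close>.\<close>

lemma Ad_preserves_line:
  assumes H: "connected_lie_subgroup G M (\<phi> ` \<hh>) H MH" and sub: "\<hh> \<subseteq> \<gg>"
    and eig: "\<And>Z. Z \<in> \<hh> \<Longrightarrow> \<exists>a. br Z (model v) = a *\<^sub>R model v"
    and v: "v \<noteq> 0" and h: "h \<in> H"
  shows "\<exists>a. a \<noteq> 0 \<and> Ad h v = a *\<^sub>R v"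
proof -
  have HG: "x \<in> carrier G" if "x \<in> H" for x
    using that H unfolding connected_lie_subgroup_def by (meson subgroup.mem_carrier)
  have ne: "Ad g v \<noteq> 0" if "g \<in> carrier G" for g
    using Ad_inv(1)[OF that, of v] v linear_0[OF Ad_linear[OF inv_closed[OF that]]] by metis
  define F where "F g = inverse (norm (Ad g v)) *\<^sub>R Ad g v" for g
  have "F h = F \<one>"
  proof (rule connected_subgroup_constant[OF H _ h])
    fix q assume "q \<in> H"
    note q = HG[OF this]
    let ?n = "norm (Ad q v)"
    let ?u = "\<lambda>x. Ad q (Ad (ci x) v)"
    have u0: "?u x0 = Ad q v" using one_in by (simp add: Ad_one)
    have u: "(?u has_derivative (\<lambda>z. Ad q (bracket z v))) (at x0)"
      by (rule bounded_linear.has_derivative[OF _ Ad_ci_has_derivative])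
         (rule Ad_linear[OF q, unfolded linear_conv_bounded_linear])
    have n: "((\<lambda>x. norm (?u x)) has_derivative (\<lambda>z. Ad q (bracket z v) \<bullet> sgn (Ad q v))) (at x0)"
      using has_derivative_compose[OF u, of norm "\<lambda>h. h \<bullet> sgn (Ad q v)"] has_derivative_norm[OF ne[OF q]] u0
      by simp
    \<comment> \<open>The quotient rule for the normalised vector. When
      \<open>Ad q (bracket z v)\<close> is a multiple of \<open>Ad q v\<close>, the two summands
      cancel.\<close>
    let ?F' = "\<lambda>z. inverse ?n *\<^sub>R Ad q (bracket z v) +
        (- (inverse ?n * (Ad q (bracket z v) \<bullet> sgn (Ad q v)) * inverse ?n)) *\<^sub>R Ad q v"
    have "((\<lambda>x. inverse (norm (?u x)) *\<^sub>R ?u x) has_derivative ?F') (at x0)"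
      using has_derivative_scaleR[OF Deriv.has_derivative_inverse[OF _ n] u] ne[OF q] by (simp add: u0)
    then have "((\<lambda>x. F (q \<otimes> ci x)) has_derivative ?F') (at x0)"
      by (rule has_derivative_transform_within_open[OF _ open_cU x0_in]) (simp add: F_def Ad_mult q)
    moreover have "?F' z = 0" if z: "left_field z \<in> \<phi> ` \<hh>" for z
    proof -
      obtain a where "br (model z) (model v) = a *\<^sub>R model v" using eig[OF model_in_image[OF sub z]] by blast
      then have "model (bracket z v) = model (a *\<^sub>R v)"
        by (simp add: model_bracket linear_cmul[OF model_linear])
      then have "bracket z v = a *\<^sub>R v" by (simp add: model_inject)
      then have "Ad q (bracket z v) = a *\<^sub>R Ad q v" by (simp add: linear_cmul[OF Ad_linear[OF q]])
      moreover have "Ad q v \<bullet> sgn (Ad q v) = ?n"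
        using ne[OF q] by (simp add: sgn_div_norm power2_norm_eq_inner[symmetric] power2_eq_square)
      ultimately show ?thesis using ne[OF q] by (simp add: scaleR_left_diff_distrib[symmetric])
    qed
    ultimately show "\<exists>F'. ((\<lambda>x. F (q \<otimes> ci x)) has_derivative F') (at x0) \<and>
        (\<forall>z. left_field z \<in> \<phi> ` \<hh> \<longrightarrow> F' z = 0)" by blast
  qed
  then have eq: "inverse (norm (Ad h v)) *\<^sub>R Ad h v = inverse (norm v) *\<^sub>R v" by (simp add: F_def Ad_one)
  have nz: "norm (Ad h v) \<noteq> 0" using ne[OF HG[OF h]] by simp
  have "Ad h v = norm (Ad h v) *\<^sub>R (inverse (norm (Ad h v)) *\<^sub>R Ad h v)" using nz by simp
  also have "\<dots> = (norm (Ad h v) * inverse (norm v)) *\<^sub>R v" unfolding eq by simp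
  finally have "Ad h v = (norm (Ad h v) * inverse (norm v)) *\<^sub>R v" .
  moreover have "norm (Ad h v) * inverse (norm v) \<noteq> 0" using nz v by simp
  ultimately show ?thesis by blast
qed

text \<open>With \<open>inv g\<close> the product \<open>q \<otimes> ci x\<close> puts
  \<open>Ad (inv (ci x))\<close> outermost, so its derivative is a bracket with \<open>z\<close>
  itself, applied to a vector depending on \<open>q\<close>. Infinitesimal invariance then applies
  directly, without knowing how \<open>Ad q\<close> moves the subalgebra.\<close>

lemma Ad_preserves_function:
  assumes H: "connected_lie_subgroup G M (\<phi> ` \<hh>) H MH" and sub: "\<hh> \<subseteq> \<gg>"
    and Q: "\<And>x. (Q has_derivative Q' x) (at x)"
    and inv: "\<And>Z x. Z \<in> \<hh> \<Longrightarrow> x \<in> \<gg> \<Longrightarrow> Q' x (br Z x) = 0"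
    and h: "h \<in> H"
  shows "Q (model (Ad (inv h) w)) = Q (model w)"
proof -
  have HG: "x \<in> carrier G" if "x \<in> H" for x
    using that H unfolding connected_lie_subgroup_def by (meson subgroup.mem_carrier)
  define F where "F g = Q (model (Ad (inv g) w))" for g
  have "F h = F \<one>"
  proof (rule connected_subgroup_constant[OF H _ h])
    fix q assume "q \<in> H"
    note q = HG[OF this]
    let ?w = "Ad (inv q) w"
    let ?u = "\<lambda>x. model (Ad (inv (ci x)) ?w)"
    have u0: "?u x0 = model ?w" using one_in by (simp add: Ad_one)
    have u: "(?u has_derivative (\<lambda>z. model (- bracket z ?w))) (at x0)"
      by (rule bounded_linear.has_derivative[OF _ Ad_inv_ci_has_derivative])
         (rule model_linear[unfolded linear_conv_bounded_linear])
    have "((\<lambda>x. Q (?u x)) has_derivative (\<lambda>z. Q' (model ?w) (model (- bracket z ?w)))) (at x0)"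
      using has_derivative_compose[OF u, of Q "Q' (model ?w)"] Q[of "model ?w"] u0 by simp
    then have "((\<lambda>x. F (q \<otimes> ci x)) has_derivative (\<lambda>z. Q' (model ?w) (model (- bracket z ?w)))) (at x0)"
      by (rule has_derivative_transform_within_open[OF _ open_cU x0_in])
         (simp add: F_def Ad_mult[symmetric] q inv_mult_group)
    moreover have "Q' (model ?w) (model (- bracket z ?w)) = 0" if z: "left_field z \<in> \<phi> ` \<hh>" for z
      using inv[OF model_in_image[OF sub z] model(1), of ?w] linear_neg[OF has_derivative_linear[OF Q]]
      by (simp add: linear_neg[OF model_linear] model_bracket)
    ultimately show "\<exists>F'. ((\<lambda>x. F (q \<otimes> ci x)) has_derivative F') (at x0) \<and>
        (\<forall>z. left_field z \<in> \<phi> ` \<hh> \<longrightarrow> F' z = 0)" by blast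
  qed
  then show ?thesis by (simp add: F_def Ad_one)
qed

lemma Ad_exp_model:
  assumes exp: "is_lie_exp G M (\<phi> X) g" and X: "X \<in> \<gg>" and P: "\<And>k. P k \<in> \<gg>"
    and step: "\<And>k. k \<le> n \<Longrightarrow> br X (P k) = real (Suc k) *\<^sub>R P (Suc k)" and Pn: "P (Suc n) = 0"
    and v: "model v = P 0"
  shows "model (Ad g v) = (\<Sum>k\<le>n. P k)"
proof -
  obtain z where z: "model z = X" "\<phi> X = left_field z" using model_surj[OF X] by blast
  have "\<forall>k. \<exists>y. model y = P k" using model_surj[OF P] by metis
  then obtain p where p: "\<And>k. model (p k) = P k" by metis
  have "p 0 = v" using v p model_inject by metis
  moreover have "Ad g (p 0) = (\<Sum>k\<le>n. p k)"
  proof (rule Ad_exp_nilpotent)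
    show "is_lie_exp G M (left_field z) g" using exp z by simp
    show "bracket z (p k) = real (Suc k) *\<^sub>R p (Suc k)" if "k \<le> n" for k
    proof -
      have "model (bracket z (p k)) = model (real (Suc k) *\<^sub>R p (Suc k))"
        using step[OF that] by (simp only: model_bracket linear_cmul[OF model_linear] p z)
      then show ?thesis by (simp only: model_inject)
    qed
    have "model (p (Suc n)) = model 0" using p Pn linear_0[OF model_linear] by simp
    then show "p (Suc n) = 0" by (simp only: model_inject)
  qed
  ultimately show ?thesis by (simp add: linear_sum[OF model_linear] p)
qed

end

section \<open>The split form of type \<open>G\<^sub>2\<close>\<close>

lemmas g2_simps = e_dn_def e_up_def e_mat_def sl_part_def tensor3_def cross3_def
  matrix_vector_mult_def matrix_matrix_mult_def transpose_def mat_def axis_def inner_vec_def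
  vec_eq_iff forall_3 sum_3

lemma trace_linear: "trace (0 :: real^3^3) = 0" "trace (A + B) = trace A + trace B"
  "trace (a *\<^sub>R A) = a * trace A" for A B :: "real^3^3"
  by (simp_all add: trace_def sum.distrib sum_distrib_left)

lemma subspace_g2_carrier: "subspace g2_carrier"
  by (auto simp: subspace_def g2_carrier_def trace_linear zero_prod_def)

lemma g2_bracket_closed:
  assumes "X \<in> g2_carrier" "Y \<in> g2_carrier" shows "g2_bracket X Y \<in> g2_carrier"
proof -
  obtain x A \<xi> y B \<eta> where "X = (x, A, \<xi>)" "Y = (y, B, \<eta>)" by (metis prod_cases3)
  then show ?thesis
    by (simp add: g2_carrier_def trace_def g2_simps algebra_simps)
qed

lemma g2_l_subset: "g2_l \<subseteq> {(x, A, \<xi>). x $ 2 = 0 \<and> x $ 3 = 0 \<and> A $ 2 $ 1 = 0 \<and> A $ 3 $ 1 = 0 \<and>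
    A $ 3 $ 2 = 0 \<and> \<xi> $ 1 = 0 \<and> trace A = 0}" (is "_ \<subseteq> ?S")
  unfolding g2_l_def
proof (rule span_minimal)
  show "subspace ?S"
    by (auto simp: subspace_def trace_linear zero_prod_def)
  show "cartan \<union> {e_dn 1, e_up 2, e_up 3, e_mat 1 2, e_mat 1 3, e_mat 2 3} \<subseteq> ?S"
    by (auto simp: cartan_def g2_simps trace_def)
qed

lemma g2_ev_subset: "g2_ev \<subseteq> {(x, A, \<xi>). x $ 1 = 0 \<and> x $ 2 = 0 \<and> A $ 1 $ 3 = 0 \<and> A $ 2 $ 3 = 0 \<and>
    A $ 3 $ 1 = 0 \<and> A $ 3 $ 2 = 0 \<and> \<xi> $ 1 = 0 \<and> \<xi> $ 2 = 0 \<and> trace A = 0}" (is "_ \<subseteq> ?S")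
  unfolding g2_ev_def
proof (rule span_minimal)
  show "subspace ?S"
    by (auto simp: subspace_def trace_linear zero_prod_def)
  show "cartan \<union> {e_dn 3, e_up 3, e_mat 1 2, e_mat 2 1} \<subseteq> ?S"
    by (auto simp: cartan_def g2_simps trace_def)
qed

lemma g2_l_carrier: "g2_l \<subseteq> g2_carrier" and g2_ev_carrier: "g2_ev \<subseteq> g2_carrier"
  using g2_l_subset g2_ev_subset by (auto simp: g2_carrier_def)

text \<open>All other coordinates of the bracket involve \<open>x $ 3\<close>,
  \<open>\<xi> $ 1\<close> or an entry of \<open>A\<close> below the diagonal, and these vanish on
  \<open>g2_l\<close>. The factor is the highest root evaluated at the diagonal of
  \<open>A\<close>.\<close>

lemma g2_l_highest_root:
  assumes "Z \<in> g2_l" shows "\<exists>a. g2_bracket Z (e_mat 1 3) = a *\<^sub>R e_mat 1 3"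
proof -
  obtain x A \<xi> where Z: "Z = (x, A, \<xi>)" by (metis prod_cases3)
  have "g2_bracket Z (e_mat 1 3) = (A $ 1 $ 1 - A $ 3 $ 3) *\<^sub>R e_mat 1 3"
    using assms g2_l_subset unfolding Z by (auto simp: g2_simps)
  then show ?thesis by blast
qed

text \<open>Up to sign, the determinant of the component in the ideal of \<open>\<gg>\<^sub>e\<^sub>v\<close> spanned by
  \<open>e\<^sub>1\<^sup>2\<close>, \<open>e\<^sub>2\<^sup>1\<close> and \<open>e\<^sub>1\<^sup>1 - e\<^sub>2\<^sup>2\<close>.\<close>

definition sl2_form :: "g2_elt \<Rightarrow> real" where
  "sl2_form z = (let A = fst (snd z) in A $ 1 $ 2 * A $ 2 $ 1 + ((A $ 1 $ 1 - A $ 2 $ 2) / 2)\<^sup>2)"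

definition sl2_form_deriv :: "g2_elt \<Rightarrow> g2_elt \<Rightarrow> real" where
  "sl2_form_deriv z y = (let A = fst (snd z); B = fst (snd y) in
     A $ 1 $ 2 * B $ 2 $ 1 + B $ 1 $ 2 * A $ 2 $ 1 + (A $ 1 $ 1 - A $ 2 $ 2) * (B $ 1 $ 1 - B $ 2 $ 2) / 2)"

lemma sl2_form_has_derivative: "(sl2_form has_derivative sl2_form_deriv z) (at z)"
proof -
  have "bounded_linear (\<lambda>z :: g2_elt. fst (snd z) $ i $ j)" for i j
    by (intro bounded_linear_compose[OF bounded_linear_vec_nth] bounded_linear_compose[OF bounded_linear_fst]
        bounded_linear_snd)
  note d = bounded_linear_imp_has_derivative[OF this]
  have "((\<lambda>z. fst (snd z) $ 1 $ 2 * fst (snd z) $ 2 $ 1 + (fst (snd z) $ 1 $ 1 - fst (snd z) $ 2 $ 2)\<^sup>2 * (1 / 4))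
      has_derivative sl2_form_deriv z) (at z)"
    by (rule has_derivative_eq_rhs, (rule derivative_intros d)+, rule ext)
       (simp add: sl2_form_deriv_def Let_def field_simps)
  moreover have "sl2_form = (\<lambda>z. fst (snd z) $ 1 $ 2 * fst (snd z) $ 2 $ 1 +
      (fst (snd z) $ 1 $ 1 - fst (snd z) $ 2 $ 2)\<^sup>2 * (1 / 4))"
    by (simp add: sl2_form_def[abs_def] Let_def power_divide)
  ultimately show ?thesis by simp
qed

text \<open>For \<open>Z\<close> in \<open>g2_ev\<close> the vectors \<open>a\<close> and
  \<open>\<alpha>\<close> have only a third coordinate, so in the upper left 2 by 2 block the two
  \<open>sl_part\<close> terms are multiples of the identity, which the form does not see. What
  remains is the commutator with the block of \<open>A\<close>, and this leaves the determinant of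
  the trace-free part infinitesimally unchanged.\<close>

lemma sl2_form_invariant:
  assumes "Z \<in> g2_ev" shows "sl2_form_deriv x (g2_bracket Z x) = 0"
proof -
  obtain a A \<alpha> where Z: "Z = (a, A, \<alpha>)" by (metis prod_cases3)
  obtain b B \<beta> where x: "x = (b, B, \<beta>)" by (metis prod_cases3)
  show ?thesis
    using assms g2_ev_subset unfolding Z x
    by (auto simp: sl2_form_deriv_def Let_def g2_simps algebra_simps add_divide_distrib diff_divide_distrib)
qed

text \<open>The terms \<open>(ad X)\<^sup>k v / k!\<close> of \<open>exp (ad X) v\<close> for \<open>v = e_mat 1 3\<close> and \<open>X\<close> the logarithm of
  \<open>a'\<close>, respectively of \<open>a''\<close>.\<close>

definition ad_series1 :: "nat \<Rightarrow> g2_elt" where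
  "ad_series1 k = (if k = 0 then e_mat 1 3 else if k = 1 then e_up 3 + e_mat 3 3 - e_mat 1 1
     else if k = 2 then - e_dn 2 - e_up 1 - e_mat 3 1 else if k = 3 then e_mat 2 1 else 0)"

definition ad_series2 :: "nat \<Rightarrow> g2_elt" where
  "ad_series2 k = (if k = 0 then e_mat 1 3 else if k = 1 then e_up 3 - e_mat 1 2
     else if k = 2 then - e_dn 2 - e_up 2 else if k = 3 then e_mat 2 1 - e_dn 3
     else if k = 4 then e_mat 3 1 else 0)"

lemma ad_series1_carrier: "ad_series1 k \<in> g2_carrier"
  by (simp add: ad_series1_def g2_carrier_def g2_simps trace_def zero_prod_def)

lemma ad_series2_carrier: "ad_series2 k \<in> g2_carrier"
  by (simp add: ad_series2_def g2_carrier_def g2_simps trace_def zero_prod_def)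

lemma nat_le_3: "k \<le> 3 \<longleftrightarrow> k = 0 \<or> k = 1 \<or> k = 2 \<or> k = (3::nat)" by arith

lemma nat_le_4: "k \<le> 4 \<longleftrightarrow> k = 0 \<or> k = 1 \<or> k = 2 \<or> k = 3 \<or> k = (4::nat)" by arith

text \<open>The case \<open>k = 3\<close> records that the last nonzero term is annihilated, so the
  series ends there.\<close>

lemma ad_series1_step:
  assumes "k \<le> 3" shows "g2_bracket (e_up 1 + e_mat 3 1) (ad_series1 k) = real (Suc k) *\<^sub>R ad_series1 (Suc k)"
  using assms unfolding nat_le_3 by (elim disjE) (simp_all add: ad_series1_def g2_simps zero_prod_def)

lemma ad_series2_step:
  assumes "k \<le> 4" shows "g2_bracket (e_mat 3 2 + e_up 1) (ad_series2 k) = real (Suc k) *\<^sub>R ad_series2 (Suc k)"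
  using assms unfolding nat_le_4 by (elim disjE) (simp_all add: ad_series2_def g2_simps zero_prod_def)

text \<open>For \<open>s = 1\<close> the upper left block has rows \<open>(-1, 0)\<close> and
  \<open>(1, 0)\<close>; its trace-free part has eigenvalues 1/2 and -1/2.\<close>

lemma sl2_form_ad_series1: "sl2_form (s *\<^sub>R (\<Sum>k\<le>3. ad_series1 k)) = s\<^sup>2 / 4"
proof -
  have "{..3::nat} = {0, 1, 2, 3}" by auto
  then show ?thesis by (simp add: ad_series1_def g2_simps sl2_form_def Let_def power2_eq_square)
qed

text \<open>For \<open>s = 1\<close> the upper left block has rows \<open>(0, -1)\<close> and
  \<open>(1, 0)\<close>, an infinitesimal rotation.\<close>

lemma sl2_form_ad_series2: "sl2_form (s *\<^sub>R (\<Sum>k\<le>4. ad_series2 k)) = - s\<^sup>2"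
proof -
  have "{..4::nat} = {0, 1, 2, 3, 4}" by auto
  then show ?thesis by (simp add: ad_series2_def g2_simps sl2_form_def Let_def power2_eq_square)
qed

theorem proposition14:
  fixes G :: "('g, 'm) monoid_scheme" (structure)
    and M :: "('g, 'e::euclidean_space) mfd"
    and \<phi> :: "g2_elt \<Rightarrow> ('g \<Rightarrow> ('g \<Rightarrow> real) \<Rightarrow> real)"
    and L G_ev :: "'g set"
    and M_L :: "('g, 'l::euclidean_space) mfd"
    and M_ev :: "('g, 'h::euclidean_space) mfd"
    and a' a'' :: 'g
    and pt pt' pt'' L' L'' :: "'g set"
    and M' M'' :: "'g set set"
  assumes "lie_group G M"
    and "simply_connected_space (mtop M)"
    and "lie_algebra_iso g2_carrier g2_bracket G M \<phi>"
    and "connected_lie_subgroup G M (\<phi> ` g2_l) L M_L"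
    and "connected_lie_subgroup G M (\<phi> ` g2_ev) G_ev M_ev"
    and "is_lie_exp G M (\<phi> (e_up 1 + e_mat 3 1)) a'"
    and "is_lie_exp G M (\<phi> (e_mat 3 2 + e_up 1)) a''"
    and "pt = \<one> <# G_ev"
    and "pt' = inv a' <# pt"
    and "pt'' = inv a'' <# pt"
    and "L' = (a' <# L) #> inv a'"
    and "L'' = (a'' <# L) #> inv a''"
    and "M' = orbit (G\<lparr>carrier := L'\<rparr>) (\<lambda>g s. g <# s) pt"
    and "M'' = orbit (G\<lparr>carrier := L''\<rparr>) (\<lambda>g s. g <# s) pt"
  shows "orbit (G\<lparr>carrier := L\<rparr>) (\<lambda>g s. g <# s) pt' \<inter>
         orbit (G\<lparr>carrier := L\<rparr>) (\<lambda>g s. g <# s) pt'' = {}"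
proof -
  note L = assms(4) and E = assms(5) and a1 = assms(6) and a2 = assms(7)
  interpret group G by (rule lie_group_group[OF assms(1)])
  obtain U c where Uc: "(U, c) \<in> charts M" "\<one> \<in> U"
    using smooth_atlas_cover[OF lie_group_atlas[OF assms(1)], of \<one>] lie_group_topspace[OF assms(1)] by auto
  interpret lie_group_model G M U c g2_carrier g2_bracket \<phi>
    using assms(1,3) Uc subspace_g2_carrier g2_bracket_closed
    by unfold_locales
  have subL: "subgroup L G" and subE: "subgroup G_ev G"
    using L E unfolding connected_lie_subgroup_def by blast+
  note LG = subgroup.mem_carrier[OF subL] and EG = subgroup.mem_carrier[OF subE]
  \<comment> \<open>\<open>is_lie_exp\<close> does not mention the carrier; membership follows
    because the one-parameter subgroup maps into the topological space of \<open>M\<close>.\<close>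
  have aG: "a' \<in> carrier G" "a'' \<in> carrier G"
    using a1 a2 smooth_map_in_topspace[of "interval_mfd UNIV" M _ 1] topspace_eq
    unfolding is_lie_exp_def by auto
  have v13: "e_mat 1 3 \<in> g2_carrier" using ad_series1_carrier[of 0] by (simp add: ad_series1_def)
  obtain v where v: "model v = e_mat 1 3" using model_surj[OF v13] by blast
  have "e_mat 1 3 \<noteq> 0" by (simp add: g2_simps zero_prod_def)
  then have v0: "v \<noteq> 0" using v linear_0[OF model_linear] by metis
  have X: "e_up 1 + e_mat 3 1 \<in> g2_carrier" "e_mat 3 2 + e_up 1 \<in> g2_carrier"
    by (simp_all add: g2_carrier_def g2_simps trace_def)
  have A1: "model (Ad a' v) = (\<Sum>k\<le>3. ad_series1 k)"
    by (rule Ad_exp_model[OF a1 X(1) ad_series1_carrier ad_series1_step]) (simp_all add: v ad_series1_def)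
  have A2: "model (Ad a'' v) = (\<Sum>k\<le>4. ad_series2 k)"
    by (rule Ad_exp_model[OF a2 X(2) ad_series2_carrier ad_series2_step]) (simp_all add: v ad_series2_def)
  have line: "\<exists>s. s \<noteq> 0 \<and> Ad (inv l) v = s *\<^sub>R v" if "l \<in> L" for l
    by (rule Ad_preserves_line[OF L g2_l_carrier _ v0 subgroup.m_inv_closed[OF subL that]])
       (simp add: v g2_l_highest_root)
  have False if l: "l1 \<in> L" "l2 \<in> L" and meet: "l1 <# pt' = l2 <# pt''" for l1 l2
  proof -
    have "pt = G_ev"
      unfolding assms(8) using EG by (auto simp: l_coset_def image_iff)
    \<comment> \<open>Since \<open>\<one>\<close> lies in \<open>G_ev\<close>, this is an element of
      the common coset, and its form in the other description of that coset yields
      \<open>h\<close>.\<close>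
    moreover have "l2 \<otimes> (inv a'' \<otimes> \<one>) \<in> l2 <# (inv a'' <# G_ev)"
      using subgroup.one_closed[OF subE] unfolding l_coset_def by blast
    ultimately have "l2 \<otimes> inv a'' \<in> l1 <# (inv a' <# G_ev)"
      using meet aG assms(9,10) by simp
    then obtain h where h: "h \<in> G_ev" and eq: "l2 \<otimes> inv a'' = l1 \<otimes> (inv a' \<otimes> h)"
      unfolding l_coset_def by auto
    obtain s1 s2 where s: "s1 \<noteq> 0" "Ad (inv l1) v = s1 *\<^sub>R v" "Ad (inv l2) v = s2 *\<^sub>R v"
      using line[OF l(1)] line[OF l(2)] by blast
    note G = LG[OF l(1)] LG[OF l(2)] EG[OF h] aG
    \<comment> \<open>Inverting \<open>eq\<close> puts \<open>inv l1\<close> and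
      \<open>inv l2\<close> next to \<open>v\<close>, which they only rescale, and
      \<open>inv h\<close> outermost, where the invariant form absorbs it.\<close>
    have "a'' \<otimes> inv l2 = inv (l2 \<otimes> inv a'')" using G by (simp add: inv_mult_group)
    also have "\<dots> = inv h \<otimes> (a' \<otimes> inv l1)" unfolding eq using G by (simp add: inv_mult_group m_assoc)
    finally have "Ad (a'' \<otimes> inv l2) v = Ad (inv h \<otimes> (a' \<otimes> inv l1)) v" by simp
    then have "s2 *\<^sub>R Ad a'' v = Ad (inv h) (s1 *\<^sub>R Ad a' v)"
      using G by (simp add: Ad_mult s linear_cmul[OF Ad_linear])
    then have "sl2_form (model (s2 *\<^sub>R Ad a'' v)) = sl2_form (model (s1 *\<^sub>R Ad a' v))"
      using Ad_preserves_function[OF E g2_ev_carrier sl2_form_has_derivative _ h] sl2_form_invariant by simp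
    then have "- s2\<^sup>2 = s1\<^sup>2 / 4"
      by (simp add: linear_cmul[OF model_linear] A1 A2 sl2_form_ad_series1 sl2_form_ad_series2)
    moreover have "s1\<^sup>2 > 0" using s(1) by simp
    moreover have "s2\<^sup>2 \<ge> 0" by simp
    ultimately show False by linarith
  qed
  then show ?thesis unfolding orbit_def by auto
qed

end
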